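(* Let $V$ be a Möbius vertex algebra. Assume that $A^{N}(V)$ is finite dimensional for all $N\in\mathbb{N}$. Then every irreducible lower-bounded generalized $V$-module is an ordinary $V$-module, and every lower-bounded generalized $V$-module of finite length is grading restricted.
   Context: Conventions: $\mathbb{N}=\{0,1,2,\dots\}$; vector spaces are over $\mathbb{C}$; $\mathrm{Res}_{x}$ is the coefficient of $x^{-1}$. A grading-restricted vertex algebra is $V=\coprod_{n\in\mathbb{Z}}V_{(n)}$ with $\dim V_{(n)}<\infty$ and $V_{(n)}=0$ for $n$ sufficiently negative, vacuum $\mathbf{1}\in V_{(0)}$, vertex operator map $Y_{V}(v,x)=\sum_{k\in\mathbb{Z}}(Y_{V})_{k}(v)x^{-k-1}$, operator $L_{V}(0)$ acting as $n$ on $V_{(n)}$ ($\mathrm{wt}\,v=n$ for $v\in V_{(n)}$) and operator $L_{V}(-1)$, satisfying the usual axioms (vacuum, creation, lower truncation, Jacobi identity, $[L_{V}(0),Y_{V}(v,x)]=x\frac{d}{dx}Y_{V}(v,x)+Y_{V}(L_{V}(0)v,x)$, $[L_{V}(-1),Y_{V}(v,x)]=Y_{V}(L_{V}(-1)v,x)=\frac{d}{dx}Y_{V}(v,x)$). A Möbius vertex algebra is a grading-restricted vertex algebra with an additional operator $L_{V}(1)$ satisfying $[L_{V}(0),L_{V}(1)]=-L_{V}(1)$, $[L_{V}(1),L_{V}(-1)]=2L_{V}(0)$ and $[L_{V}(1),Y_{V}(v,x)]=Y_{V}((L_{V}(1)+2xL_{V}(0)+x^{2}L_{V}(-1))v,x)$.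 A lower-bounded generalized module for a grading-restricted vertex algebra $V$ is a space $W=\coprod_{n\in\mathbb{C}}W_{[n]}$ with $W_{[n]}=0$ when $\Re(n)$ is sufficiently negative, a vertex operator map $Y_{W}(v,x)=\sum_{k\in\mathbb{Z}}(Y_{W})_{k}(v)x^{-k-1}$ and operators $L_{W}(0),L_{W}(-1)$, satisfying the usual module axioms (lower truncation, $Y_W(\mathbf 1,x)=1$, Jacobi identity, the $L(0)$- and $L(-1)$-commutator formulas, the $L(-1)$-derivative property, $[L_W(0),L_W(-1)]=L_W(-1)$), where $W_{[n]}$ is the generalized eigenspace of $L_{W}(0)$ with eigenvalue $n$ (possibly infinite dimensional). For a Möbius vertex algebra, a lower-bounded generalized $V$-module also has an operator $L_{W}(1)$ satisfying the same relations as $L_{V}(1)$. Generalized $V$-submodules are subspaces invariant under all these operators; irreducible means nonzero with no nonzero proper generalized $V$-submodule. $W$ is of finite length if there is a finite chain of submodules $W=W_{0}\supset\cdots\supset W_{l+1}=0$ with each $W_{i}/W_{i+1}$ irreducible. $W$ is grading restricted if moreover $\dim W_{[n]}<\infty$ for all $n\in\mathbb{C}$; an ordinary $V$-module is a grading-restricted one on which $L_{W}(0)$ acts semisimply. The algebra $A^{N}(V)$ is defined regarding $V$ as a grading-restricted vertex algebra, as follows. $U^{\infty}(V)$ is the space of column-finite matrices $[v_{kl}]_{k,l\in\mathbb{N}}$ with entries in $V$ (for each $l$, only finitely many $v_{kl}\neq 0$), and $U^{N}(V)$ is the subspace of those whose $(k,l)$ entries vanish whenever $k>N$ or $l>N$.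 For a lower-bounded generalized $V$-module $W$ and $n\in\mathbb{N}$ let $\Omega_{n}(W)=\{w\in W: (Y_{W})_{k}(v)w=0$ for all homogeneous $v\in V$ and $k\in\mathbb{Z}$ with $\mathrm{wt}\,v-k-1<-n\}$, $\Omega_{-1}(W)=0$, $Gr_{n}(W)=\Omega_{n}(W)/\Omega_{n-1}(W)$, $Gr(W)=\coprod_{n\in\mathbb{N}}Gr_{n}(W)$, and $[w]_{n}=w+\Omega_{n-1}(W)$ for $w\in\Omega_n(W)$. Define $\vartheta_{Gr(W)}:U^{\infty}(V)\to\mathrm{End}\,Gr(W)$ by $\vartheta_{Gr(W)}([v_{kl}])[w]_{l}=\sum_{k\in\mathbb{N}}[\mathrm{Res}_{x}x^{l-k-1}Y_{W}(x^{L_{V}(0)}v_{kl},x)w]_{k}$ for $w\in\Omega_{l}(W)$, $l\in\mathbb{N}$. Let $Q^{\infty}(V)=\bigcap_{W}\ker\vartheta_{Gr(W)}$ over all lower-bounded generalized $V$-modules $W$. Then $A^{N}(V)=\{\mathfrak{v}+Q^{\infty}(V)\mid\mathfrak{v}\in U^{N}(V)\}\subset U^{\infty}(V)/Q^{\infty}(V)$. *)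

theory Defs
  imports
    Complex_Main
    "HOL-Library.Function_Algebras"
    "HOL-Library.Set_Algebras"
    "HOL-Library.Groups_Big_Fun"
begin

section \<open>Complex vector spaces on carrier sets, quotients, finite dimension\<close>

text \<open>
  The addition is that of the ambient type. It is used both for subspaces of a vector space and
  for sets of cosets, whose sum is the elementwise sum of \<^theory>\<open>HOL-Library.Set_Algebras\<close>; the
  zero vector is therefore not part of the data.
\<close>

record 'a cspace =
  car :: "'a set"
  scl :: "complex \<Rightarrow> 'a \<Rightarrow> 'a"

definition subspace_in :: "('a::plus, 'z) cspace_scheme \<Rightarrow> 'a set \<Rightarrow> bool" where
  "subspace_in C S \<longleftrightarrow> S \<noteq> {} \<and> S \<subseteq> car C \<and>
     (\<forall>x\<in>S. \<forall>y\<in>S. x + y \<in> S) \<and> (\<forall>c. \<forall>x\<in>S. scl C c x \<in> S)"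

definition finite_dimensional :: "('a::plus, 'z) cspace_scheme \<Rightarrow> bool" where
  "finite_dimensional C \<longleftrightarrow>
     (\<exists>B. finite B \<and> B \<subseteq> car C \<and> (\<forall>S. subspace_in C S \<and> B \<subseteq> S \<longrightarrow> S = car C))"

text \<open>
  An operator acts on cosets of \<open>D\<close> by \<open>x + D \<mapsto> f x + D\<close>. Adding \<open>D\<close> to the
  image is needed because \<open>f\<close> may map \<open>D\<close> to a proper subset of \<open>D\<close> (e.g. scaling by \<open>0\<close>).
\<close>

definition on_cosets :: "'a::plus set \<Rightarrow> ('a \<Rightarrow> 'a) \<Rightarrow> 'a set \<Rightarrow> 'a set" where
  "on_cosets D f X = f ` X + D"

definition cosets :: "'a::plus set \<Rightarrow> 'a set \<Rightarrow> 'a set set" where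
  "cosets S D = {x +o D | x. x \<in> S}"


section \<open>Grading-restricted and Moebius vertex algebras\<close>

text \<open>
  \<open>vY V u k v\<close> is \<open>(Y\<^sub>V)\<^sub>k(u)v\<close>, the coefficient of \<open>x\<close> to the power \<open>-k-1\<close> in \<open>Y\<^sub>V(u,x)v\<close>. The algebra
  occupies the whole type \<open>'v\<close>. Its grading is encoded by \<open>L\<^sub>V(0)\<close>, which acts on \<open>V\<^sub>(\<^sub>n\<^sub>)\<close> as \<open>n\<close>.
\<close>

record 'v va_data =
  vscl :: "complex \<Rightarrow> 'v \<Rightarrow> 'v"
  vac :: 'v
  vY :: "'v \<Rightarrow> int \<Rightarrow> 'v \<Rightarrow> 'v"
  vL0 :: "'v \<Rightarrow> 'v"
  vLm1 :: "'v \<Rightarrow> 'v"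

record 'v mva_data = "'v va_data" +
  vL1 :: "'v \<Rightarrow> 'v"

definition weight_space :: "('v, 'z) va_data_scheme \<Rightarrow> int \<Rightarrow> 'v set" where
  "weight_space V n = {v. vL0 V v = vscl V (of_int n) v}"

text \<open>
  The Jacobi identity applied to \<open>w\<close>, as the equality of the coefficients of
  \<open>x\<^sub>0\<close>, \<open>x\<^sub>1\<close>, \<open>x\<^sub>2\<close> to the powers \<open>-l-1\<close>, \<open>-m-1\<close>, \<open>-n-1\<close> for all integers \<open>l\<close>, \<open>m\<close>, \<open>n\<close>; the
  binomial series are expanded in nonnegative powers of the second variable. All sums have finite
  support by lower truncation.
\<close>

definition jacobi_identity ::
  "('v \<Rightarrow> int \<Rightarrow> 'v \<Rightarrow> 'v) \<Rightarrow> (complex \<Rightarrow> 'w \<Rightarrow> 'w) \<Rightarrow> ('v \<Rightarrow> int \<Rightarrow> 'w \<Rightarrow> 'w::ab_group_add)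
     \<Rightarrow> 'v \<Rightarrow> 'v \<Rightarrow> 'w \<Rightarrow> bool" where
  "jacobi_identity YV s Y u v w \<longleftrightarrow> (\<forall>l m n.
     Sum_any (\<lambda>i::nat. s ((-1) ^ i * (of_int l gchoose i))
         (Y u (m + l - int i) (Y v (n + int i) w)))
     - s ((-1) powi l) (Sum_any (\<lambda>i::nat. s ((-1) ^ i * (of_int l gchoose i))
         (Y v (n + l - int i) (Y u (m + int i) w))))
     = Sum_any (\<lambda>i::nat. s (of_int m gchoose i) (Y (YV u (l + int i) v) (m + n - int i) w)))"

definition grading_restricted_va :: "('v::ab_group_add, 'z) va_data_scheme \<Rightarrow> bool" where
  "grading_restricted_va V \<longleftrightarrow>
     vector_space (vscl V) \<and>
     Vector_Spaces.linear (vscl V) (vscl V) (vL0 V) \<and>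
     Vector_Spaces.linear (vscl V) (vscl V) (vLm1 V) \<and>
     (\<forall>u k. Vector_Spaces.linear (vscl V) (vscl V) (vY V u k)) \<and>
     (\<forall>v k. Vector_Spaces.linear (vscl V) (vscl V) (\<lambda>u. vY V u k v)) \<and>
     \<comment> \<open>the sum of the eigenspaces is automatically direct\<close>
     module.span (vscl V) (\<Union>n. weight_space V n) = UNIV \<and>
     (\<forall>n. finite_dimensional \<lparr>car = weight_space V n, scl = vscl V\<rparr>) \<and>
     (\<exists>N. \<forall>n<N. weight_space V n = {0}) \<and>
     vac V \<in> weight_space V 0 \<and>
     (\<forall>k v. vY V (vac V) k v = (if k = -1 then v else 0)) \<and>
     (\<forall>v. vY V v (-1) (vac V) = v \<and> (\<forall>k\<ge>0. vY V v k (vac V) = 0)) \<and>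
     (\<forall>u v. \<exists>K. \<forall>k\<ge>K. vY V u k v = 0) \<and>
     (\<forall>u v w. jacobi_identity (vY V) (vscl V) (vY V) u v w) \<and>
     (\<forall>v k w. vL0 V (vY V v k w) - vY V v k (vL0 V w) =
        vscl V (of_int (- k - 1)) (vY V v k w) + vY V (vL0 V v) k w) \<and>
     (\<forall>v k w. vLm1 V (vY V v k w) - vY V v k (vLm1 V w) = vY V (vLm1 V v) k w) \<and>
     (\<forall>v k w. vY V (vLm1 V v) k w = vscl V (of_int (- k)) (vY V v (k - 1) w))"

definition moebius_va :: "('v::ab_group_add, 'z) mva_data_scheme \<Rightarrow> bool" where
  "moebius_va V \<longleftrightarrow>
     grading_restricted_va V \<and>
     Vector_Spaces.linear (vscl V) (vscl V) (vL1 V) \<and>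
     (\<forall>v. vL0 V (vL1 V v) - vL1 V (vL0 V v) = - vL1 V v) \<and>
     (\<forall>v. vL1 V (vLm1 V v) - vLm1 V (vL1 V v) = vscl V 2 (vL0 V v)) \<and>
     (\<forall>v k w. vL1 V (vY V v k w) - vY V v k (vL1 V w) =
        vY V (vL1 V v) k w + vscl V 2 (vY V (vL0 V v) (k + 1) w) + vY V (vLm1 V v) (k + 2) w)"


section \<open>Lower-bounded generalized modules\<close>

text \<open>
  A module is carried by a subspace \<open>car W\<close> of the ambient vector space on the type \<open>'w\<close>; the
  operations are constrained on \<open>car W\<close> only.
\<close>

record ('v, 'w) vmod_data = "'w cspace" +
  mY :: "'v \<Rightarrow> int \<Rightarrow> 'w \<Rightarrow> 'w"
  mL0 :: "'w \<Rightarrow> 'w"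
  mLm1 :: "'w \<Rightarrow> 'w"

record ('v, 'w) mvmod_data = "('v, 'w) vmod_data" +
  mL1 :: "'w \<Rightarrow> 'w"

definition operator_on :: "('w::plus, 'z) cspace_scheme \<Rightarrow> ('w \<Rightarrow> 'w) \<Rightarrow> bool" where
  "operator_on W T \<longleftrightarrow>
     (\<forall>x\<in>car W. T x \<in> car W) \<and>
     (\<forall>x\<in>car W. \<forall>y\<in>car W. T (x + y) = T x + T y) \<and>
     (\<forall>c. \<forall>x\<in>car W. T (scl W c x) = scl W c (T x))"

definition gen_weight_space :: "('v, 'w::ab_group_add, 'z) vmod_data_scheme \<Rightarrow> complex \<Rightarrow> 'w set" where
  "gen_weight_space W n =
     {w \<in> car W. \<exists>p. ((\<lambda>x. mL0 W x - scl W n x) ^^ p) w = 0}"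

definition lower_bounded_gen_module ::
  "('v::ab_group_add, 'y) va_data_scheme \<Rightarrow> ('v, 'w::ab_group_add, 'z) vmod_data_scheme \<Rightarrow> bool" where
  "lower_bounded_gen_module V W \<longleftrightarrow>
     vector_space (scl W) \<and> module.subspace (scl W) (car W) \<and>
     operator_on W (mL0 W) \<and> operator_on W (mLm1 W) \<and>
     (\<forall>v k. operator_on W (mY W v k)) \<and>
     (\<forall>k. \<forall>w\<in>car W. Vector_Spaces.linear (vscl V) (scl W) (\<lambda>v. mY W v k w)) \<and>
     \<comment> \<open>the sum of the generalized eigenspaces is automatically direct\<close>
     module.span (scl W) (\<Union>n. gen_weight_space W n) = car W \<and>
     (\<exists>B::real. \<forall>n. Re n < B \<longrightarrow> gen_weight_space W n = {0}) \<and>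
     (\<forall>v. \<forall>w\<in>car W. \<exists>K. \<forall>k\<ge>K. mY W v k w = 0) \<and>
     (\<forall>k. \<forall>w\<in>car W. mY W (vac V) k w = (if k = -1 then w else 0)) \<and>
     (\<forall>u v. \<forall>w\<in>car W. jacobi_identity (vY V) (scl W) (mY W) u v w) \<and>
     (\<forall>v k. \<forall>w\<in>car W. mL0 W (mY W v k w) - mY W v k (mL0 W w) =
        scl W (of_int (- k - 1)) (mY W v k w) + mY W (vL0 V v) k w) \<and>
     (\<forall>v k. \<forall>w\<in>car W. mLm1 W (mY W v k w) - mY W v k (mLm1 W w) = mY W (vLm1 V v) k w) \<and>
     (\<forall>v k. \<forall>w\<in>car W. mY W (vLm1 V v) k w = scl W (of_int (- k)) (mY W v (k - 1) w)) \<and>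
     (\<forall>w\<in>car W. mL0 W (mLm1 W w) - mLm1 W (mL0 W w) = mLm1 W w)"

definition lower_bounded_gen_moebius_module ::
  "('v::ab_group_add, 'y) mva_data_scheme \<Rightarrow> ('v, 'w::ab_group_add, 'z) mvmod_data_scheme \<Rightarrow> bool" where
  "lower_bounded_gen_moebius_module V W \<longleftrightarrow>
     lower_bounded_gen_module V W \<and>
     operator_on W (mL1 W) \<and>
     (\<forall>w\<in>car W. mL0 W (mL1 W w) - mL1 W (mL0 W w) = - mL1 W w) \<and>
     (\<forall>w\<in>car W. mL1 W (mLm1 W w) - mLm1 W (mL1 W w) = scl W 2 (mL0 W w)) \<and>
     (\<forall>v k. \<forall>w\<in>car W. mL1 W (mY W v k w) - mY W v k (mL1 W w) =
        mY W (vL1 V v) k w + scl W 2 (mY W (vL0 V v) (k + 1) w) + mY W (vLm1 V v) (k + 2) w)"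

definition gen_submodule :: "('v, 'w::plus, 'z) mvmod_data_scheme \<Rightarrow> 'w set \<Rightarrow> bool" where
  "gen_submodule W S \<longleftrightarrow> subspace_in W S \<and>
     (\<forall>w\<in>S. (\<forall>v k. mY W v k w \<in> S) \<and> mL0 W w \<in> S \<and> mLm1 W w \<in> S \<and> mL1 W w \<in> S)"

text \<open>A subspace is zero iff it is a singleton.\<close>

definition irreducible_gen_module :: "('v, 'w::plus, 'z) mvmod_data_scheme \<Rightarrow> bool" where
  "irreducible_gen_module W \<longleftrightarrow>
     \<not> is_singleton (car W) \<and> (\<forall>S. gen_submodule W S \<longrightarrow> is_singleton S \<or> S = car W)"

definition quotient_gen_module ::
  "('v, 'w::plus, 'z) mvmod_data_scheme \<Rightarrow> 'w set \<Rightarrow> 'w set \<Rightarrow> ('v, 'w set) mvmod_data" where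
  "quotient_gen_module W S D =
     \<lparr>car = cosets S D, scl = (\<lambda>c. on_cosets D (scl W c)),
      mY = (\<lambda>v k. on_cosets D (mY W v k)), mL0 = on_cosets D (mL0 W),
      mLm1 = on_cosets D (mLm1 W), mL1 = on_cosets D (mL1 W)\<rparr>"

definition finite_length :: "('v, 'w::ab_group_add, 'z) mvmod_data_scheme \<Rightarrow> bool" where
  "finite_length W \<longleftrightarrow> (\<exists>(l::nat) F.
     F 0 = car W \<and> F (Suc l) = {0} \<and> (\<forall>i\<le>Suc l. gen_submodule W (F i)) \<and>
     (\<forall>i\<le>l. F (Suc i) \<subset> F i \<and> irreducible_gen_module (quotient_gen_module W (F i) (F (Suc i)))))"

definition grading_restricted_module ::
  "('v::ab_group_add, 'y) mva_data_scheme \<Rightarrow> ('v, 'w::ab_group_add, 'z) mvmod_data_scheme \<Rightarrow> bool" where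
  "grading_restricted_module V W \<longleftrightarrow>
     lower_bounded_gen_moebius_module V W \<and>
     (\<forall>n. finite_dimensional \<lparr>car = gen_weight_space W n, scl = scl W\<rparr>)"

text \<open>Over the complex numbers, a locally finite operator is semisimple iff it is diagonalizable.\<close>

definition ordinary_module ::
  "('v::ab_group_add, 'y) mva_data_scheme \<Rightarrow> ('v, 'w::ab_group_add, 'z) mvmod_data_scheme \<Rightarrow> bool" where
  "ordinary_module V W \<longleftrightarrow>
     grading_restricted_module V W \<and>
     module.span (scl W) {w \<in> car W. \<exists>n. mL0 W w = scl W n w} = car W"


section \<open>The algebras \<open>A\<^sup>N(V)\<close>\<close>

definition weight_component :: "('v::ab_group_add, 'y) va_data_scheme \<Rightarrow> int \<Rightarrow> 'v \<Rightarrow> 'v" where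
  "weight_component V n v =
     (THE f. (\<forall>m. f m \<in> weight_space V m) \<and> finite {m. f m \<noteq> 0} \<and> Sum_any f = v) n"

definition U_inf :: "(nat \<Rightarrow> nat \<Rightarrow> 'v::zero) set" where
  "U_inf = {M. \<forall>l. finite {k. M k l \<noteq> 0}}"

definition U_fin :: "nat \<Rightarrow> (nat \<Rightarrow> nat \<Rightarrow> 'v::zero) set" where
  "U_fin N = {M \<in> U_inf. \<forall>k l. k > N \<or> l > N \<longrightarrow> M k l = 0}"

text \<open>The index is an integer so that \<open>\<Omega>\<^sub>-\<^sub>1(W) = 0\<close> is included.\<close>

definition Omega ::
  "('v, 'y) va_data_scheme \<Rightarrow> ('v, 'w::zero, 'z) vmod_data_scheme \<Rightarrow> int \<Rightarrow> 'w set" where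
  "Omega V W n = (if n < 0 then {0} else
     {w \<in> car W. \<forall>m. \<forall>v\<in>weight_space V m. \<forall>k. m - k - 1 < - n \<longrightarrow> mY W v k w = 0})"

definition Gr_comp ::
  "('v, 'y) va_data_scheme \<Rightarrow> ('v, 'w::{zero,plus}, 'z) vmod_data_scheme \<Rightarrow> nat \<Rightarrow> 'w set set" where
  "Gr_comp V W n = cosets (Omega V W (int n)) (Omega V W (int n - 1))"

text \<open>The direct sum: finitely supported families; \<open>\<Omega>\<^sub>n\<^sub>-\<^sub>1(W)\<close> is the zero of \<open>Gr\<^sub>n(W)\<close>.\<close>

definition Gr ::
  "('v, 'y) va_data_scheme \<Rightarrow> ('v, 'w::{zero,plus}, 'z) vmod_data_scheme \<Rightarrow> (nat \<Rightarrow> 'w set) set" where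
  "Gr V W = {g. (\<forall>n. g n \<in> Gr_comp V W n) \<and> finite {n. g n \<noteq> Omega V W (int n - 1)}}"

text \<open>
  \<open>residue_action V W k l v w\<close> is the residue of \<open>x\<close> to the power \<open>l-k-1\<close> times
  \<open>Y\<^sub>W(x\<^sup>L\<^sup>(\<^sup>0\<^sup>)v,x)w\<close>. A component of weight \<open>n\<close> contributes the coefficient of \<open>x\<close>
  to the power \<open>-(n+l-k-1)-1\<close> in its vertex operator.
\<close>

definition residue_action ::
  "('v::ab_group_add, 'y) va_data_scheme \<Rightarrow> ('v, 'w::ab_group_add, 'z) vmod_data_scheme
     \<Rightarrow> nat \<Rightarrow> nat \<Rightarrow> 'v \<Rightarrow> 'w \<Rightarrow> 'w" where
  "residue_action V W k l v w =
     Sum_any (\<lambda>n::int. mY W (weight_component V n v) (n + int l - int k - 1) w)"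

text \<open>
  The \<open>k\<close>-th component of the image of \<open>g\<close> is the sum over \<open>l\<close> of the cosets modulo
  \<open>\<Omega>\<^sub>k\<^sub>-\<^sub>1(W)\<close> represented by the residue action of the \<open>(k,l)\<close> entry on a representative of \<open>g l\<close>;
  the residue action maps \<open>\<Omega>\<^sub>l(W)\<close> to \<open>\<Omega>\<^sub>k(W)\<close> and \<open>\<Omega>\<^sub>l\<^sub>-\<^sub>1(W)\<close> to \<open>\<Omega>\<^sub>k\<^sub>-\<^sub>1(W)\<close>.
\<close>

definition theta_Gr ::
  "('v::ab_group_add, 'y) va_data_scheme \<Rightarrow> ('v, 'w::ab_group_add, 'z) vmod_data_scheme
     \<Rightarrow> (nat \<Rightarrow> nat \<Rightarrow> 'v) \<Rightarrow> (nat \<Rightarrow> 'w set) \<Rightarrow> nat \<Rightarrow> 'w set" where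
  "theta_Gr V W M g k =
     (\<Sum>l \<in> {l. g l \<noteq> Omega V W (int l - 1)}. residue_action V W k l (M k l) ` g l)
     + Omega V W (int k - 1)"

definition ker_theta_Gr ::
  "('v::ab_group_add, 'y) va_data_scheme \<Rightarrow> ('v, 'w::ab_group_add, 'z) vmod_data_scheme
     \<Rightarrow> (nat \<Rightarrow> nat \<Rightarrow> 'v) set" where
  "ker_theta_Gr V W =
     {M \<in> U_inf. \<forall>g\<in>Gr V W. theta_Gr V W M g = (\<lambda>k. Omega V W (int k - 1))}"

text \<open>
  The intersection over all modules is taken over those carried by subspaces of the
  sequence type \<open>nat \<Rightarrow> complex\<close>. This is no restriction when \<open>V\<close> is a grading-restricted vertex
  algebra: \<open>M\<close> is outside the kernel for \<open>W\<close> iff some \<open>w\<close> in some \<open>\<Omega>\<^sub>l(W)\<close> has, for some \<open>k\<close>,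
  residue action of \<open>M k l\<close> outside \<open>\<Omega>\<^sub>k\<^sub>-\<^sub>1(W)\<close>. The submodule \<open>W'\<close> generated by \<open>w\<close> satisfies
  \<open>\<Omega>\<^sub>n(W') = \<Omega>\<^sub>n(W) \<inter> W'\<close>, hence detects \<open>M\<close> as well, and it has countable dimension
  because \<open>V\<close> has; so it is isomorphic to a module on a space of finitely supported sequences.
  The modules are those of \<open>V\<close> as a grading-restricted vertex algebra, without \<open>L\<^sub>W(1)\<close>.
\<close>

definition Q_inf :: "('v::ab_group_add, 'y) va_data_scheme \<Rightarrow> (nat \<Rightarrow> nat \<Rightarrow> 'v) set" where
  "Q_inf V = {M \<in> U_inf. \<forall>W :: ('v, nat \<Rightarrow> complex) vmod_data.
     lower_bounded_gen_module V W \<longrightarrow> M \<in> ker_theta_Gr V W}"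

text \<open>\<open>A\<^sup>N(V)\<close> as a vector space; its product is not needed.\<close>

definition A_alg ::
  "('v::ab_group_add, 'y) va_data_scheme \<Rightarrow> nat \<Rightarrow> (nat \<Rightarrow> nat \<Rightarrow> 'v) set cspace" where
  "A_alg V N =
     \<lparr>car = cosets (U_fin N) (Q_inf V),
      scl = (\<lambda>c. on_cosets (Q_inf V) (\<lambda>M k l. vscl V c (M k l)))\<rparr>"

end

theory Submission
  imports Defs "HOL-Library.Countable_Set"
begin

text \<open>
  Let \<open>W\<close> be irreducible of lowest weight \<open>h\<close>. The span of the \<open>L(0)\<close>-eigenvectors is a nonzero
  submodule, so \<open>L(0)\<close> acts semisimply. If a nonzero \<open>x\<close> of weight \<open>h + n\<close> satisfies
  \<open>L(1)x = 0\<close>, then the vectors \<open>L(-1)\<^sup>iY\<^sub>k(v)x\<close> span a submodule, hence \<open>W\<close>; reading off weight \<open>h\<close>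
  (where terms with \<open>i > 0\<close> vanish, since \<open>Y\<^sub>k(v)x\<close> has weight below \<open>h\<close>) shows that the modes of degree \<open>-n\<close>
  map \<open>x\<close> onto \<open>W\<^sub>[\<^sub>h\<^sub>]\<close>. By finite dimensionality of \<open>A\<^sup>n(V)\<close> finitely many of these modes \<open>o(u)\<close> suffice
  on \<open>\<Omega>\<^sub>n(W)\<close>. The case \<open>n = 0\<close> shows that \<open>W\<^sub>[\<^sub>h\<^sub>]\<close> is finite dimensional. For \<open>n > 0\<close> the
  map \<open>L(1)\<close> to weight \<open>h + n - 1\<close> and the maps \<open>o(u)\<close> to \<open>W\<^sub>[\<^sub>h\<^sub>]\<close> have no common kernel in
  weight \<open>h + n\<close>, and induction on \<open>n\<close> applies. Finite dimensionality of the weight spaces passes to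
  extensions.
\<close>

section \<open>Linear algebra on subspaces\<close>

text \<open>Membership in \<open>Q_inf V\<close> is a condition on the graded spaces Gr(W), not on
  W, so finite dimensionality of \<open>A_alg V n\<close> does not directly bound modes on W. Row 0
  is the exception: its values are taken modulo Omega_{-1}(W) = 0, so the (0,n) entry of a matrix in
  \<open>Q_inf V\<close> literally annihilates Omega_n(W). Hence only modes landing in the lowest
  weight space are controlled, and L(1) has to link the intermediate weights. A vector with L(1)x
  nonzero is seen one weight lower; if L(1)x = 0, the subspace generated by x under modes and L(-1)
  is stable under L(1), which irreducibility of a Moebius module requires. The finitely many modes
  are chosen for all of Omega_n(W) at once, and this uniformity lets a finite family of linear maps
  detect every x.

  Two matters of types intervene. \<open>Q_inf\<close> tests modules of sequences only, so an
  irreducible W must be shown to be countably spanned. Operators of a module are constrained only on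
  its carrier, so linearity is taken relative to a subset, and subquotients have to be realized
  inside a type that is a vector space.\<close>

definition linear_on :: "('a::field \<Rightarrow> 'b::ab_group_add \<Rightarrow> 'b) \<Rightarrow> ('a \<Rightarrow> 'c::ab_group_add \<Rightarrow> 'c) \<Rightarrow>
    'b set \<Rightarrow> ('b \<Rightarrow> 'c) \<Rightarrow> bool" where
  "linear_on s t C f \<longleftrightarrow> (\<forall>x\<in>C. \<forall>y\<in>C. f (x + y) = f x + f y) \<and> (\<forall>c. \<forall>x\<in>C. f (s c x) = t c (f x))"

lemma linear_on_add: "linear_on s t C f \<Longrightarrow> x \<in> C \<Longrightarrow> y \<in> C \<Longrightarrow> f (x + y) = f x + f y"
  and linear_on_scale: "linear_on s t C f \<Longrightarrow> x \<in> C \<Longrightarrow> f (s c x) = t c (f x)"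
  by (auto simp: linear_on_def)

lemma linear_on_subset: "linear_on s t C f \<Longrightarrow> D \<subseteq> C \<Longrightarrow> linear_on s t D f"
  unfolding linear_on_def by blast

definition shift_by :: "('a::field \<Rightarrow> 'b::ab_group_add \<Rightarrow> 'b) \<Rightarrow> ('b \<Rightarrow> 'b) \<Rightarrow> 'a \<Rightarrow> 'b \<Rightarrow> 'b" where
  "shift_by s T a x = T x - s a x"

text \<open>The target \<open>F\<close> lets one notion serve several purposes: \<open>{0}\<close>
  gives the generalized weight spaces, a submodule governs restriction to it, and the kernel of a
  homomorphism governs images.\<close>

definition gen_eigenspace ::
  "('a::field \<Rightarrow> 'b::ab_group_add \<Rightarrow> 'b) \<Rightarrow> 'b set \<Rightarrow> ('b \<Rightarrow> 'b) \<Rightarrow> 'b set \<Rightarrow> 'a \<Rightarrow> 'b set" where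
  "gen_eigenspace s C T F a = {x \<in> C. \<exists>p. (shift_by s T a ^^ p) x \<in> F}"

lemma gen_eigenspace_mono: "F \<subseteq> F' \<Longrightarrow> gen_eigenspace s C T F a \<subseteq> gen_eigenspace s C T F' a"
  unfolding gen_eigenspace_def by blast

text \<open>The spanning set need not lie in \<open>S\<close>, so \<open>S\<close> need not be a
  subspace and the property passes to arbitrary subsets at once.\<close>

definition fin_dim :: "('a::field \<Rightarrow> 'b::ab_group_add \<Rightarrow> 'b) \<Rightarrow> 'b set \<Rightarrow> bool" where
  "fin_dim s S \<longleftrightarrow> (\<exists>B. finite B \<and> S \<subseteq> module.span s B)"

context vector_space_pair
begin

lemma linear_on_zero:
  assumes "linear_on s1 s2 C f" "vs1.subspace C"
  shows "f 0 = 0"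
  using linear_on_scale[OF assms(1) vs1.subspace_0[OF assms(2)], of 0] by simp

lemma linear_on_diff:
  assumes f: "linear_on s1 s2 C f" and C: "vs1.subspace C" and x: "x \<in> C" "y \<in> C"
  shows "f (x - y) = f x - f y"
proof -
  have "f (x - y + y) = f (x - y) + f y"
    using linear_on_add[OF f _ x(2)] vs1.subspace_diff[OF C x] by blast
  then show ?thesis by (simp add: algebra_simps)
qed

lemma linear_on_sum:
  assumes "linear_on s1 s2 C f" "vs1.subspace C" "\<And>i. i \<in> A \<Longrightarrow> g i \<in> C"
  shows "f (sum g A) = (\<Sum>i\<in>A. f (g i))"
  using assms(3)
proof (induction A rule: infinite_finite_induct)
  case (insert i A)
  then show ?case
    using linear_on_add[OF assms(1), of "g i" "sum g A"] vs1.subspace_sum[OF assms(2), of A g]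
    by simp
qed (simp_all add: linear_on_zero[OF assms(1,2)])

lemma linear_on_image_subspace:
  assumes "linear_on s1 s2 C f" "vs1.subspace C"
  shows "vs2.subspace (f ` C)"
proof (rule vs2.subspaceI)
  show "0 \<in> f ` C"
    using linear_on_zero[OF assms] vs1.subspace_0[OF assms(2)] by (metis imageI)
  show "x + y \<in> f ` C" if "x \<in> f ` C" "y \<in> f ` C" for x y
    using that linear_on_add[OF assms(1)] vs1.subspace_add[OF assms(2)]
    by (auto simp: image_iff) metis
  show "s2 c x \<in> f ` C" if "x \<in> f ` C" for c x
    using that linear_on_scale[OF assms(1)] vs1.subspace_scale[OF assms(2)]
    by (auto simp: image_iff) metis
qed

lemma linear_on_kernel_subspace:
  assumes "linear_on s1 s2 C f" "vs1.subspace C" "vs2.subspace D"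
  shows "vs1.subspace {x \<in> C. f x \<in> D}"
  by (rule vs1.subspaceI)
    (auto simp: linear_on_zero[OF assms(1,2)] linear_on_add[OF assms(1)] linear_on_scale[OF assms(1)]
      vs1.subspace_0[OF assms(2)] vs1.subspace_add[OF assms(2)] vs1.subspace_scale[OF assms(2)]
      vs2.subspace_0[OF assms(3)] intro: vs2.subspace_add[OF assms(3)] vs2.subspace_scale[OF assms(3)])

lemma linear_on_span_image:
  assumes "linear_on s1 s2 C f" "vs1.subspace C" "G \<subseteq> C" "vs2.subspace D"
    and "\<And>g. g \<in> G \<Longrightarrow> f g \<in> D" "x \<in> vs1.span G"
  shows "f x \<in> D"
  using vs1.span_minimal[OF _ linear_on_kernel_subspace[OF assms(1,2,4)], of G] assms(3,5,6)
  by blast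

text \<open>\<open>Sum_any\<close> is \<open>0\<close> on infinite supports, so \<open>f\<close> must not shrink the support of \<open>g\<close>.\<close>

lemma linear_on_Sum_any:
  assumes f: "linear_on s1 s2 C f" and C: "vs1.subspace C"
    and g: "\<And>i. g i \<in> C" and inj: "\<And>i. f (g i) = 0 \<Longrightarrow> g i = 0"
  shows "f (Sum_any g) = Sum_any (\<lambda>i. f (g i))"
proof -
  have "{i. f (g i) \<noteq> 0} = {i. g i \<noteq> 0}"
    using inj linear_on_zero[OF f C] by auto
  then show ?thesis
    unfolding Sum_any.expand_set by (simp add: linear_on_sum[OF f C] g)
qed

text \<open>Here \<open>f\<close> may shrink the support, as a projection does; finiteness of the
  original support takes the place of injectivity on the terms.\<close>

lemma linear_on_Sum_any_finite:
  assumes f: "linear_on s1 s2 C f" and C: "vs1.subspace C"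
    and g: "\<And>i. g i \<in> C" and fin: "finite {i. g i \<noteq> 0}"
  shows "f (Sum_any g) = Sum_any (\<lambda>i. f (g i))"
proof -
  have "{i. f (g i) \<noteq> 0} \<subseteq> {i. g i \<noteq> 0}"
    using linear_on_zero[OF f C] by auto
  then have "Sum_any (\<lambda>i. f (g i)) = (\<Sum>i\<in>{i. g i \<noteq> 0}. f (g i))"
    by (rule Sum_any.expand_superset[OF fin])
  then show ?thesis
    unfolding Sum_any.expand_set[of g] by (simp add: linear_on_sum[OF f C] g)
qed

end

context vector_space
begin

lemma subspace_Sum_any:
  assumes "subspace S" "\<And>i. f i \<in> S"
  shows "Sum_any f \<in> S"
  unfolding Sum_any.expand_set by (rule subspace_sum[OF assms])

lemma span_Union_decompose:
  assumes G: "\<And>i. subspace (G i)" and x: "x \<in> span (\<Union>i. G i)"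
  obtains f where "\<And>i. f i \<in> G i" "finite {i. f i \<noteq> 0}" "x = Sum_any f"
proof -
  let ?S = "{x. \<exists>f. (\<forall>i. f i \<in> G i) \<and> finite {i. f i \<noteq> 0} \<and> x = Sum_any f}"
  have "subspace ?S"
  proof (rule subspaceI)
    show "0 \<in> ?S"
      using subspace_0[OF G] by (intro CollectI exI[of _ "\<lambda>_. 0"]) simp
  next
    fix x y assume "x \<in> ?S" "y \<in> ?S"
    then obtain f g where f: "\<forall>i. f i \<in> G i" "finite {i. f i \<noteq> 0}" "x = Sum_any f"
      and g: "\<forall>i. g i \<in> G i" "finite {i. g i \<noteq> 0}" "y = Sum_any g"
      by blast
    have "finite {i. f i + g i \<noteq> 0}"
      by (rule finite_subset[OF _ finite_UnI[OF f(2) g(2)]]) auto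
    moreover have "x + y = Sum_any (\<lambda>i. f i + g i)"
      unfolding f(3) g(3) by (rule Sum_any.distrib[OF f(2) g(2), symmetric])
    ultimately show "x + y \<in> ?S"
      by (intro CollectI exI[of _ "\<lambda>i. f i + g i"] conjI allI subspace_add[OF G] f(1)[rule_format]
        g(1)[rule_format])
  next
    fix c x assume "x \<in> ?S"
    then obtain f where f: "\<forall>i. f i \<in> G i" "finite {i. f i \<noteq> 0}" "x = Sum_any f"
      by blast
    interpret vector_space_pair scale scale ..
    have "finite {i. scale c (f i) \<noteq> 0}"
      by (rule finite_subset[OF _ f(2)]) auto
    moreover have "linear_on scale scale UNIV (scale c)"
      by (auto simp: linear_on_def scale_right_distrib mult.commute)
    then have "scale c x = Sum_any (\<lambda>i. scale c (f i))"
      unfolding f(3) by (rule linear_on_Sum_any_finite) (use f in auto)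
    ultimately show "scale c x \<in> ?S"
      by (intro CollectI exI[of _ "\<lambda>i. scale c (f i)"] conjI allI subspace_scale[OF G]
        f(1)[rule_format])
  qed
  moreover have "(\<Union>i. G i) \<subseteq> ?S"
  proof
    fix x assume "x \<in> (\<Union>i. G i)"
    then obtain i where i: "x \<in> G i" by blast
    let ?f = "\<lambda>j. if j = i then x else 0"
    have "finite {j. ?f j \<noteq> 0}" by (rule finite_subset[of _ "{i}"]) auto
    moreover have "Sum_any ?f = x"
      by (subst Sum_any.expand_superset[of "{i}"]) auto
    ultimately show "x \<in> ?S"
      using i subspace_0[OF G] by (intro CollectI exI[of _ ?f]) auto
  qed
  ultimately have "x \<in> ?S"
    using span_minimal x by blast
  then show thesis using that by blast
qed

section \<open>Generalized eigenspaces modulo an invariant subspace\<close>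

lemma linear_on_funpow:
  assumes "linear_on scale scale C f" "f ` C \<subseteq> C"
  shows "linear_on scale scale C (f ^^ p)" "(f ^^ p) ` C \<subseteq> C"
proof -
  have "linear_on scale scale C (f ^^ p) \<and> (f ^^ p) ` C \<subseteq> C"
  proof (induction p)
    case 0 then show ?case by (auto simp: linear_on_def)
  next
    case (Suc p)
    then have sub: "\<And>x. x \<in> C \<Longrightarrow> (f ^^ p) x \<in> C" by blast
    with Suc assms show ?case
      by (auto simp: linear_on_def)
  qed
  then show "linear_on scale scale C (f ^^ p)" "(f ^^ p) ` C \<subseteq> C" by auto
qed

lemma linear_on_shift_by:
  assumes "linear_on scale scale C T" "T ` C \<subseteq> C" "subspace C"
  shows "linear_on scale scale C (shift_by scale T a)" "shift_by scale T a ` C \<subseteq> C"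
proof -
  show "linear_on scale scale C (shift_by scale T a)"
    using assms(1) by (auto simp: linear_on_def shift_by_def algebra_simps scale_right_distrib
      scale_right_diff_distrib)
  show "shift_by scale T a ` C \<subseteq> C"
    using assms(2) subspace_diff[OF assms(3)] subspace_scale[OF assms(3)]
    by (auto simp: shift_by_def)
qed

text \<open>
  The spaces \<open>gen_eigenspace scale C T F a\<close> are the preimages of the generalized eigenspaces
  of \<open>T\<close> on \<open>C / F\<close>.
\<close>

lemma gen_eigenspaces_independent_mod:
  assumes T: "linear_on scale scale C T" "T ` C \<subseteq> C" and C: "subspace C"
    and F: "subspace F" "F \<subseteq> C" "T ` F \<subseteq> F"
    and fin: "finite A" and x: "\<And>a. a \<in> A \<Longrightarrow> x a \<in> gen_eigenspace scale C T F a"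
    and sum: "sum x A \<in> F" and a: "a \<in> A"
  shows "x a \<in> F"
proof -
  interpret vp: vector_space_pair scale scale ..
  note D = linear_on_shift_by[OF T C] and DF = linear_on_shift_by(2)[OF linear_on_subset[OF T(1) F(2)] F(3,1)]
  note Dp = linear_on_funpow[OF D] and DpF = linear_on_funpow(2)[OF linear_on_subset[OF D(1) F(2)] DF]
  have D_in: "shift_by scale T b y \<in> C" if "y \<in> C" for b y using D(2) that by blast
  have DF_in: "shift_by scale T b y \<in> F" if "y \<in> F" for b y using DF that by blast
  have Dp_in: "(shift_by scale T b ^^ p) y \<in> C" if "y \<in> C" for b p y using Dp(2) that by blast
  have DpF_in: "(shift_by scale T b ^^ p) y \<in> F" if "y \<in> F" for b p y using DpF that by blast
  have comm: "shift_by scale T b (shift_by scale T c y) = shift_by scale T c (shift_by scale T b y)" if "y \<in> C" for b c y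
  proof -
    have "T y \<in> C" using T that by blast
    then have "T (T y - scale d y) = T (T y) - scale d (T y)" for d
      using vp.linear_on_diff[OF T(1) C, of "T y" "scale d y"] linear_on_scale[OF T(1) that]
        subspace_scale[OF C that] by simp
    then show ?thesis
      unfolding shift_by_def
      by (simp add: scale_right_diff_distrib algebra_simps)
  qed
  have comm': "(shift_by scale T c ^^ q) (shift_by scale T b y) = shift_by scale T b ((shift_by scale T c ^^ q) y)" if "y \<in> C" for b c q y
    using that by (induction q) (auto simp: comm Dp_in)
  have comm'': "(shift_by scale T c ^^ q) ((shift_by scale T b ^^ p) y) = (shift_by scale T b ^^ p) ((shift_by scale T c ^^ q) y)"
    if "y \<in> C" for b c p q y
    using that by (induction p) (auto simp: comm' Dp_in)
  \<comment> \<open>Two eigenvalues cannot share a vector modulo \<open>F\<close>: by induction on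
    \<open>p + q\<close>, both (T - b)y and (T - c)y lie in \<open>F\<close>, since each lowers one
    exponent and commutes with the other operator. Their difference is (c - b)y.\<close>
  have pair: "y \<in> F" if "y \<in> C" "(shift_by scale T b ^^ p) y \<in> F" "(shift_by scale T c ^^ q) y \<in> F" "b \<noteq> c" for b c p q y
    using that(1-3)
  proof (induction "p + q" arbitrary: p q y rule: less_induct)
    case less
    show ?case
    proof (cases "p = 0 \<or> q = 0")
      case True with less show ?thesis by auto
    next
      case False
      then obtain p' q' where pq: "p = Suc p'" "q = Suc q'" by (meson nat.exhaust)
      have Suc: "(f ^^ n) (f z) = (f ^^ Suc n) z" for f :: "'b \<Rightarrow> 'b" and n z
        by (simp add: funpow_Suc_right del: funpow.simps(2))
      have "(shift_by scale T b ^^ p') (shift_by scale T b y) \<in> F"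
        "(shift_by scale T c ^^ q') (shift_by scale T c y) \<in> F"
        unfolding Suc using less.prems pq by simp_all
      moreover have "(shift_by scale T c ^^ q) (shift_by scale T b y) \<in> F"
        "(shift_by scale T b ^^ p) (shift_by scale T c y) \<in> F"
        using less.prems DF_in by (simp_all only: comm')
      ultimately have "shift_by scale T b y \<in> F" "shift_by scale T c y \<in> F"
        using less.hyps[of p' q "shift_by scale T b y"] less.hyps[of p q' "shift_by scale T c y"]
          D_in[OF less.prems(1)] pq by simp_all
      then have "scale (inverse (c - b)) (shift_by scale T b y - shift_by scale T c y) \<in> F"
        by (intro subspace_scale subspace_diff F)
      also have "shift_by scale T b y - shift_by scale T c y = scale (c - b) y"
        by (simp add: shift_by_def scale_left_diff_distrib)
      finally show ?thesis using \<open>b \<noteq> c\<close> by simp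
    qed
  qed
  show ?thesis
    using fin x sum a
  proof (induction A arbitrary: x a rule: finite_induct)
    case empty then show ?case by simp
  next
    case (insert b A)
    have xC: "x c \<in> C" if "c \<in> insert b A" for c
      using insert.prems(1)[OF that] by (simp add: gen_eigenspace_def)
    obtain p where p: "(shift_by scale T b ^^ p) (x b) \<in> F"
      using insert.prems(1)[of b] by (auto simp: gen_eigenspace_def)
    \<comment> \<open>This power moves the \<open>b\<close> summand into \<open>F\<close> and leaves
      a relation with one term fewer, whose terms are still generalized eigenvectors because all the
      shifts of \<open>T\<close> commute. What the induction then gives about the images is undone
      by \<open>pair\<close>.\<close>
    have "(shift_by scale T b ^^ p) (sum x (insert b A)) \<in> F"
      by (rule DpF_in) (use insert in auto)
    moreover have "(shift_by scale T b ^^ p) (sum x (insert b A)) =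
        (shift_by scale T b ^^ p) (x b) + (\<Sum>c\<in>A. (shift_by scale T b ^^ p) (x c))"
      by (subst vp.linear_on_sum[OF Dp(1) C]) (use insert.hyps xC in auto)
    ultimately have "(\<Sum>c\<in>A. (shift_by scale T b ^^ p) (x c)) \<in> F"
      using subspace_diff[OF F(1) _ p] by (metis add_diff_cancel_left')
    moreover have "(shift_by scale T b ^^ p) (x c) \<in> gen_eigenspace scale C T F c" if c: "c \<in> A" for c
    proof -
      obtain q where q: "(shift_by scale T c ^^ q) (x c) \<in> F" and "x c \<in> C"
        using insert.prems(1)[OF insertI2[OF c]] by (auto simp: gen_eigenspace_def)
      then have "(shift_by scale T c ^^ q) ((shift_by scale T b ^^ p) (x c)) \<in> F"
        by (simp add: comm'' DpF_in)
      then show ?thesis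
        using \<open>x c \<in> C\<close> Dp_in by (auto simp: gen_eigenspace_def)
    qed
    ultimately have in_A: "(shift_by scale T b ^^ p) (x c) \<in> F" if "c \<in> A" for c
      using insert.IH[of "\<lambda>c. (shift_by scale T b ^^ p) (x c)"] that by blast
    have A: "x c \<in> F" if c: "c \<in> A" for c
    proof -
      obtain q where q: "(shift_by scale T c ^^ q) (x c) \<in> F"
        using insert.prems(1)[OF insertI2[OF c]] by (auto simp: gen_eigenspace_def)
      show ?thesis
        by (rule pair[OF _ in_A[OF c] q]) (use c insert.hyps xC in auto)
    qed
    then have "sum x A \<in> F" by (rule subspace_sum[OF F(1)])
    then have "x b \<in> F"
      using insert.prems(2) insert.hyps subspace_diff[OF F(1), of "sum x (insert b A)" "sum x A"] by simp
    with A insert.prems(3) show ?case by blast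
  qed
qed

text \<open>Decompose \<open>x\<close> along the \<open>G b\<close> and subtract \<open>x\<close>
  from the component at \<open>a\<close>. The difference is again a generalized eigenvector for
  \<open>a\<close>, the new family sums to zero, and independence modulo \<open>F\<close> puts the
  difference into \<open>F\<close>.\<close>

lemma gen_eigenspace_component:
  assumes T: "linear_on scale scale C T" "T ` C \<subseteq> C" and C: "subspace C"
    and F: "subspace F" "F \<subseteq> C" "T ` F \<subseteq> F"
    and G: "\<And>b. subspace (G b)" "\<And>b. G b \<subseteq> gen_eigenspace scale C T F b"
    and x: "x \<in> gen_eigenspace scale C T F a" "x \<in> span (\<Union>b. G b)"
  shows "\<exists>y\<in>G a. x - y \<in> F"
proof -
  obtain f where f: "\<And>b. f b \<in> G b" "finite {b. f b \<noteq> 0}" "x = Sum_any f"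
    using span_Union_decompose[OF G(1) x(2)] by blast
  let ?A = "insert a {b. f b \<noteq> 0}"
  let ?g = "\<lambda>b. if b = a then f a - x else f b"
  interpret vp: vector_space_pair scale scale ..
  note Dp = linear_on_funpow[OF linear_on_shift_by[OF T C]]
    and DpF = linear_on_funpow(2)[OF linear_on_subset[OF linear_on_shift_by(1)[OF T C] F(2)]
      linear_on_shift_by(2)[OF linear_on_subset[OF T(1) F(2)] F(3,1)]]
  have diff: "f a - x \<in> gen_eigenspace scale C T F a"
  proof -
    obtain p where p: "(shift_by scale T a ^^ p) x \<in> F" and xC: "x \<in> C"
      using x by (auto simp: gen_eigenspace_def)
    obtain q where q: "(shift_by scale T a ^^ q) (f a) \<in> F" and fC: "f a \<in> C"
      using f(1)[of a] G(2)[of a] by (auto simp: gen_eigenspace_def)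
    have "(shift_by scale T a ^^ (p + q)) x \<in> F"
      using DpF[where p=q] p by (subst add.commute, subst funpow_add) auto
    moreover have "(shift_by scale T a ^^ (p + q)) (f a) \<in> F"
      using DpF[where p=p] q by (subst funpow_add) auto
    ultimately have "(shift_by scale T a ^^ (p + q)) (f a - x) \<in> F"
      using subspace_diff[OF F(1)] vp.linear_on_diff[OF Dp(1) C fC xC] by simp
    then show ?thesis
      using subspace_diff[OF C fC xC] by (auto simp: gen_eigenspace_def)
  qed
  have fin: "finite {b. f b \<noteq> 0}" by (rule f(2))
  have "x = sum f ?A"
    unfolding f(3) by (rule Sum_any.expand_superset) (use fin in auto)
  also have "\<dots> = f a + sum f ({b. f b \<noteq> 0} - {a})"
    by (rule sum.insert_remove[OF fin])
  also have "sum f ({b. f b \<noteq> 0} - {a}) = sum ?g ({b. f b \<noteq> 0} - {a})"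
    by (rule sum.cong) auto
  finally have "sum ?g ?A = 0"
    by (subst sum.insert_remove[OF fin]) (simp only: if_True algebra_simps simp_thms, simp)
  then have "?g a \<in> F"
    using f(1) G(2) diff f(2) subspace_0[OF F(1)]
    by (intro gen_eigenspaces_independent_mod[OF T C F, of ?A ?g]) (auto split: if_splits)
  then have "x - f a \<in> F"
    using subspace_neg[OF F(1), of "f a - x"] by simp
  then show ?thesis using f(1) by blast
qed

section \<open>Finite-dimensional subspaces\<close>

lemma fin_dim_subset: "fin_dim scale T \<Longrightarrow> S \<subseteq> T \<Longrightarrow> fin_dim scale S"
  unfolding fin_dim_def by blast

lemma fin_dim_zero: "fin_dim scale {0}"
  unfolding fin_dim_def by (rule exI[of _ "{}"]) simp

lemma fin_dim_basis:
  assumes "fin_dim scale S"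
  obtains B where "finite B" "B \<subseteq> S" "S \<subseteq> span B"
proof -
  obtain A where A: "finite A" "S \<subseteq> span A" using assms by (auto simp: fin_dim_def)
  obtain B where B: "B \<subseteq> S" "independent B" "S \<subseteq> span B"
    using maximal_independent_subset by blast
  then have "finite B"
    using independent_span_bound[OF A(1) B(2)] A(2) by blast
  with B that show thesis by blast
qed

lemma fin_dim_kernel_image:
  assumes f: "linear_on scale scale S f" and S: "subspace S"
    and im: "fin_dim scale (f ` S)" and ker: "fin_dim scale {x \<in> S. f x = 0}"
  shows "fin_dim scale S"
proof -
  interpret vp: vector_space_pair scale scale ..
  obtain B where B: "finite B" "B \<subseteq> f ` S" "f ` S \<subseteq> span B"
    using fin_dim_basis[OF im] by blast
  obtain K where K: "finite K" "{x \<in> S. f x = 0} \<subseteq> span K"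
    using ker by (auto simp: fin_dim_def)
  obtain g where g: "\<And>b. b \<in> B \<Longrightarrow> g b \<in> S \<and> f (g b) = b"
    using B(2) by (metis image_iff subsetD)
  have "S \<subseteq> span (K \<union> g ` B)"
  proof
    fix x assume x: "x \<in> S"
    then obtain c where c: "f x = (\<Sum>b\<in>B. scale (c b) b)"
      using B(3) span_finite[OF B(1)] by auto
    let ?y = "\<Sum>b\<in>B. scale (c b) (g b)"
    have y: "?y \<in> S" by (intro subspace_sum[OF S] subspace_scale[OF S]) (use g in blast)
    have "f ?y = (\<Sum>b\<in>B. f (scale (c b) (g b)))"
      by (rule vp.linear_on_sum[OF f S]) (use g subspace_scale[OF S] in blast)
    also have "\<dots> = f x"
      unfolding c by (rule sum.cong) (use g linear_on_scale[OF f] in auto)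
    finally have "x - ?y \<in> {x \<in> S. f x = 0}"
      using vp.linear_on_diff[OF f S x y] subspace_diff[OF S x y] by simp
    then have "x - ?y \<in> span (K \<union> g ` B)"
      using K(2) span_mono[of K "K \<union> g ` B"] by blast
    moreover have "?y \<in> span (K \<union> g ` B)"
      by (intro span_sum span_scale span_base) auto
    ultimately show "x \<in> span (K \<union> g ` B)"
      using span_add[of "x - ?y" _ ?y] by simp
  qed
  then show ?thesis
    unfolding fin_dim_def using K(1) B(1) by (intro exI[of _ "K \<union> g ` B"]) auto
qed

text \<open>Each map is peeled off by passing to its kernel, at the cost of a finite-dimensional
  image. Applied to a weight space, the images lie in lower weights and the common kernel is
  zero.\<close>

lemma fin_dim_common_kernel:
  assumes "finite I" "subspace S" "\<And>f. f \<in> I \<Longrightarrow> linear_on scale scale S f"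
    "\<And>f. f \<in> I \<Longrightarrow> fin_dim scale (f ` S)" "fin_dim scale {x \<in> S. \<forall>f\<in>I. f x = 0}"
  shows "fin_dim scale S"
  using assms
proof (induction I arbitrary: S rule: finite_induct)
  case empty then show ?case by simp
next
  case (insert f I)
  interpret vp: vector_space_pair scale scale ..
  let ?K = "{x \<in> S. f x = 0}"
  have f: "linear_on scale scale S f" using insert.prems by blast
  have "subspace ?K"
    using vp.linear_on_kernel_subspace[OF f insert.prems(1) subspace_single_0] by simp
  moreover have "linear_on scale scale ?K g" "fin_dim scale (g ` ?K)" if "g \<in> I" for g
    using insert.prems(2,3)[of g] that
    by (auto intro: linear_on_subset fin_dim_subset)
  moreover have "{x \<in> ?K. \<forall>g\<in>I. g x = 0} = {x \<in> S. \<forall>g\<in>insert f I. g x = 0}" by auto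
  ultimately have "fin_dim scale ?K"
    using insert.IH[of ?K] insert.prems(4) by simp
  then show ?case
    using fin_dim_kernel_image[OF f insert.prems(1)] insert.prems(3) by blast
qed

end

lemma subspace_in_iff:
  assumes "vector_space (scl C)"
  shows "subspace_in C S \<longleftrightarrow> module.subspace (scl C) S \<and> S \<subseteq> car C"
proof -
  interpret vector_space "scl C" by fact
  have "0 \<in> S" if "x \<in> S" "\<forall>c. \<forall>x\<in>S. scl C c x \<in> S" for x
    using that scale_zero_left by metis
  then show ?thesis
    by (auto simp: subspace_in_def subspace_def)
qed

text \<open>An ambient vector space on the type is required, so this serves weight spaces; the coset
  space \<open>A_alg V N\<close> is handled by choosing representatives.\<close>

lemma finite_dimensional_iff_fin_dim:
  assumes "vector_space s" "module.subspace s C"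
  shows "finite_dimensional \<lparr>car = C, scl = s\<rparr> \<longleftrightarrow> fin_dim s C"
proof -
  interpret vector_space s by fact
  have sub: "subspace_in \<lparr>car = C, scl = s\<rparr> S \<longleftrightarrow> subspace S \<and> S \<subseteq> C" for S
    using assms(1) by (subst subspace_in_iff) simp_all
  show ?thesis
  proof
    assume "finite_dimensional \<lparr>car = C, scl = s\<rparr>"
    then obtain B where B: "finite B" "B \<subseteq> C"
      "\<And>S. module.subspace s S \<Longrightarrow> S \<subseteq> C \<Longrightarrow> B \<subseteq> S \<Longrightarrow> S = C"
      unfolding finite_dimensional_def sub by auto
    then have "span B = C"
      using span_minimal[OF B(2) assms(2)] span_superset by blast
    with B(1) show "fin_dim s C" by (auto simp: fin_dim_def)
  next
    assume "fin_dim s C"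
    then obtain B where B: "finite B" "B \<subseteq> C" "C \<subseteq> span B"
      by (rule fin_dim_basis)
    have "S = C" if "module.subspace s S" "S \<subseteq> C" "B \<subseteq> S" for S
      using span_minimal[OF that(3,1)] that(2) B(3) by blast
    with B(1,2) show "finite_dimensional \<lparr>car = C, scl = s\<rparr>"
      unfolding finite_dimensional_def sub
      by (intro exI[of _ B] conjI allI impI) simp_all
  qed
qed

section \<open>Cosets, countable coordinates and complements\<close>

context vector_space
begin

lemma subspace_set_plus: "subspace D \<Longrightarrow> S \<subseteq> D \<Longrightarrow> S \<noteq> {} \<Longrightarrow> S + D = D"
proof (intro equalityI subsetI)
  fix x assume D: "subspace D" "S \<subseteq> D" "S \<noteq> {}"
  { assume "x \<in> S + D" then show "x \<in> D"
      using D subspace_add[OF D(1)] by (auto simp: set_plus_def) }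
  { assume x: "x \<in> D"
    obtain s where s: "s \<in> S" using D(3) by blast
    then have "x - s \<in> D" using D(2) x subspace_diff[OF D(1)] by blast
    then have "s + (x - s) \<in> S + D" using s by (intro set_plus_intro)
    then show "x \<in> S + D" by simp }
qed

text \<open>This is how a value of \<open>theta_Gr\<close> is recognized as a zero coset. An empty
  or infinite sum of sets is \<open>{0}\<close>, which adding \<open>D\<close> absorbs as
  well.\<close>

lemma subspace_sum_set_plus:
  assumes D: "subspace D" and S: "\<And>i. i \<in> A \<Longrightarrow> S i \<subseteq> D \<and> S i \<noteq> {}"
  shows "sum S A + D = D"
  using S
proof (induction A rule: infinite_finite_induct)
  case (insert i A)
  then have "sum S (insert i A) + D = S i + (sum S A + D)"
    by (simp add: add.assoc)
  also have "\<dots> = D" using insert subspace_set_plus[OF D] by simp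
  finally show ?case .
qed simp_all

lemma coset_eq_iff: "subspace D \<Longrightarrow> x +o D = y +o D \<longleftrightarrow> x - y \<in> D"
proof
  assume D: "subspace D" and "x +o D = y +o D"
  moreover have "x + 0 \<in> x +o D" using subspace_0[OF D] by (rule set_plus_intro2)
  ultimately show "x - y \<in> D" by (auto simp: elt_set_plus_def)
next
  assume D: "subspace D" and xy: "x - y \<in> D"
  show "x +o D = y +o D"
  proof (intro equalityI subsetI)
    fix z
    { assume "z \<in> x +o D"
      then have "z - x \<in> D" by (simp add: set_minus_plus[symmetric] elt_set_plus_def) auto
      then have "y + ((z - x) + (x - y)) \<in> y +o D"
        using xy subspace_add[OF D] by (intro set_plus_intro2)
      then show "z \<in> y +o D" by simp }
    { assume "z \<in> y +o D"
      then have "z - y \<in> D" by (auto simp: elt_set_plus_def)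
      then have "x + ((z - y) - (x - y)) \<in> x +o D"
        using xy subspace_diff[OF D] by (intro set_plus_intro2)
      then show "z \<in> x +o D" by simp }
  qed
qed

lemma coset_self: "subspace D \<Longrightarrow> x \<in> x +o D"
  using set_plus_intro2[of 0 D x] subspace_0 by simp

lemma coset_zero: "(0 :: 'b) +o D = D"
  unfolding elt_set_plus_def by auto

lemma coset_eq_self_iff: "subspace D \<Longrightarrow> x +o D = D \<longleftrightarrow> x \<in> D"
  using coset_eq_iff[of D x 0] by (simp add: coset_zero)

lemma coset_plus: "subspace D \<Longrightarrow> (x +o D) + (y +o D) = (x + y) +o D"
  using subspace_set_plus[of D D] subspace_0[of D]
  by (auto simp: set_plus_rearrange)

lemma on_cosets_coset:
  assumes f: "linear_on scale scale C f" and C: "subspace C" and D: "subspace D" "D \<subseteq> C" "f ` D \<subseteq> D"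
    and x: "x \<in> C"
  shows "on_cosets D f (x +o D) = f x +o D"
proof -
  have "f ` (x +o D) = f x +o f ` D"
    using linear_on_add[OF f x] D(2) by (auto simp: elt_set_plus_def image_iff subset_iff) metis+
  moreover have "(f x +o f ` D) + D = f x +o (f ` D + D)"
    by (simp add: set_plus_rearrange2[symmetric] add.commute set_plus_rearrange4)
  moreover have "f ` D + D = D"
    by (rule subspace_set_plus[OF D(1,3)]) (use subspace_0[OF D(1)] in blast)
  ultimately show ?thesis by (simp add: on_cosets_def)
qed

text \<open>The map takes coordinates in a basis contained in \<open>G\<close>, enumerated by
  \<open>to_nat_on\<close>. It carries a countably spanned module to the sequence type over which
  \<open>Q_inf\<close> quantifies.\<close>

lemma countable_span_embedding:
  assumes "countable G"
  obtains \<phi> :: "'b \<Rightarrow> nat \<Rightarrow> 'a" where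
    "linear_on scale (\<lambda>c f n. c * f n) (span G) \<phi>" "\<And>x. x \<in> span G \<Longrightarrow> \<phi> x = 0 \<Longrightarrow> x = 0"
proof -
  obtain B where B: "B \<subseteq> G" "independent B" "G \<subseteq> span B"
    using maximal_independent_subset by blast
  have span: "span G = span B"
    using B span_mono[OF B(1)] span_minimal[OF B(3) subspace_span] by blast
  have inj: "inj_on (to_nat_on B) B"
    using B(1) assms countable_subset by (intro inj_on_to_nat_on) blast
  define \<phi> where "\<phi> x n = (if n \<in> to_nat_on B ` B then representation B x (from_nat_into B n) else 0)"
    for x n
  have \<phi>: "\<phi> x (to_nat_on B b) = representation B x b" if "b \<in> B" for x b
    using that by (simp add: \<phi>_def from_nat_into_to_nat_on[OF countable_subset[OF B(1) assms]])
  have "linear_on scale (\<lambda>c f n. c * f n) (span G) \<phi>"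
    by (auto simp: linear_on_def span \<phi>_def fun_eq_iff representation_add[OF B(2)]
      representation_scale[OF B(2)])
  moreover have "x = 0" if x: "x \<in> span G" "\<phi> x = 0" for x
  proof -
    have "representation B x b = 0" for b
      using representation_ne_zero[of B x b] \<phi>[of b x] that by (auto simp: fun_eq_iff)
    then show ?thesis
      using sum_nonzero_representation_eq[OF B(2), of x] x span by simp
  qed
  ultimately show thesis by (rule that)
qed

lemma subspace_is_singleton_iff: "subspace S \<Longrightarrow> is_singleton S \<longleftrightarrow> S = {0}"
  using subspace_0 by (auto simp: is_singleton_def)

lemma complement_projection:
  assumes D: "subspace D" and F: "subspace F" and DF: "D \<subseteq> F"
  obtains p where "linear_on scale scale UNIV p" "\<And>x. x \<in> D \<Longrightarrow> p x = 0"
    "\<And>x. x \<in> F \<Longrightarrow> x - p x \<in> D"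
proof -
  interpret vp: vector_space_pair scale scale ..
  obtain B where B: "B \<subseteq> D" "independent B" "D \<subseteq> span B"
    using maximal_independent_subset by blast
  obtain B' where B': "B \<subseteq> B'" "B' \<subseteq> F" "independent B'" "F \<subseteq> span B'"
    by (rule maximal_independent_subset_extend[OF order_trans[OF B(1) DF] B(2)])
  obtain p where p: "Vector_Spaces.linear scale scale p" "\<forall>b\<in>B'. p b = (if b \<in> B then 0 else b)"
    using vp.linear_independent_extend[OF B'(3), of "\<lambda>b. if b \<in> B then 0 else b"] by blast
  have lin: "linear_on scale scale UNIV p"
    using p(1) by (simp add: linear_on_def vp.linear_add vp.linear_scale)
  have 1: "p x = 0" if "x \<in> D" for x
  proof -
    have "p x \<in> {0}"
      by (rule vp.linear_on_span_image[OF lin subspace_UNIV subset_UNIV subspace_single_0, of B])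
        (use p(2) B B'(1) that in auto)
    then show ?thesis by simp
  qed
  have lin': "linear_on scale scale UNIV (\<lambda>x. x - p x)"
    using lin by (simp add: linear_on_def scale_right_diff_distrib)
  have "x - p x \<in> D" if "x \<in> F" for x
    by (rule vp.linear_on_span_image[OF lin' subspace_UNIV subset_UNIV D, of B'])
      (use p(2) B(1) B'(4) that subspace_0[OF D] in auto)
  with lin 1 show thesis by (rule that)
qed

end

section \<open>Vertex algebras and their modules\<close>

locale vertex_algebra =
  fixes V :: "('v::ab_group_add, 'y) va_data_scheme"
  assumes grading_restricted: "grading_restricted_va V"
begin

sublocale V: vector_space "vscl V"
  using grading_restricted by (simp add: grading_restricted_va_def)

lemma linear_vL0: "Vector_Spaces.linear (vscl V) (vscl V) (vL0 V)"
  and span_weight_spaces: "V.span (\<Union>n. weight_space V n) = UNIV"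
  and finite_dimensional_weight_space: "finite_dimensional \<lparr>car = weight_space V n, scl = vscl V\<rparr>"
  using grading_restricted by (simp_all add: grading_restricted_va_def)

lemma lower_truncation_V: "\<exists>K. \<forall>k\<ge>K. vY V u k v = 0"
  using grading_restricted by (simp add: grading_restricted_va_def)

lemma linear_on_vL0: "linear_on (vscl V) (vscl V) UNIV (vL0 V)"
  using linear_vL0 by (auto simp: linear_on_def Vector_Spaces.linear_iff)

lemma subspace_weight_space: "V.subspace (weight_space V n)"
proof -
  interpret L0: Vector_Spaces.linear "vscl V" "vscl V" "vL0 V" by (rule linear_vL0)
  show ?thesis
    by (rule V.subspaceI)
      (auto simp: weight_space_def L0.zero L0.add L0.scale V.scale_right_distrib mult.commute)
qed

lemma weight_decomposition_unique:
  assumes f: "\<And>m. f m \<in> weight_space V m" "finite {m. f m \<noteq> 0}"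
    and g: "\<And>m. g m \<in> weight_space V m" "finite {m. g m \<noteq> 0}"
    and eq: "Sum_any f = Sum_any g"
  shows "f = g"
proof (rule ext, rule ccontr)
  fix m assume m: "f m \<noteq> g m"
  interpret L0: Vector_Spaces.linear "vscl V" "vscl V" "vL0 V" by (rule linear_vL0)
  define A where "A = {m. f m \<noteq> 0} \<union> {m. g m \<noteq> 0}"
  \<comment> \<open>Independence is stated for complex eigenvalues while the grading of V is by
    integers; the floor of the real part recovers \<open>n\<close> from \<open>of_int n\<close>, and
    no other arguments occur.\<close>
  define x where "x a = f \<lfloor>Re a\<rfloor> - g \<lfloor>Re a\<rfloor>" for a :: complex
  have fin: "finite A" using f(2) g(2) by (simp add: A_def)
  have "sum x (of_int ` A) = (\<Sum>m\<in>A. f m - g m)"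
    by (subst sum.reindex) (auto simp: inj_on_def x_def)
  also have "\<dots> = sum f A - sum g A" by (rule sum_subtractf)
  also have "sum f A = Sum_any f"
    by (rule Sum_any.expand_superset[symmetric, OF fin]) (auto simp: A_def)
  also have "sum g A = Sum_any g"
    by (rule Sum_any.expand_superset[symmetric, OF fin]) (auto simp: A_def)
  finally have sum: "sum x (of_int ` A) \<in> {0}" using eq by simp
  have "x a \<in> gen_eigenspace (vscl V) UNIV (vL0 V) {0} a" if "a \<in> of_int ` A" for a
  proof -
    obtain n where n: "a = of_int n" using \<open>a \<in> of_int ` A\<close> by blast
    have "f n - g n \<in> weight_space V n"
      by (rule V.subspace_diff[OF subspace_weight_space f(1) g(1)])
    then show ?thesis
      by (auto simp: gen_eigenspace_def x_def n weight_space_def shift_by_def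
        intro!: exI[of _ "Suc 0"])
  qed
  moreover have "m \<in> A" using m by (auto simp: A_def)
  ultimately have "x (of_int m) \<in> {0}"
    using V.gen_eigenspaces_independent_mod[OF linear_on_vL0 _ V.subspace_UNIV V.subspace_single_0
      _ _ _ _ sum, of "of_int m"] fin L0.zero
    by auto
  then show False using m by (simp add: x_def)
qed

lemma weight_component:
  "weight_component V m v \<in> weight_space V m"
  "finite {m. weight_component V m v \<noteq> 0}"
  "Sum_any (\<lambda>m. weight_component V m v) = v"
  and weight_component_eqI: "\<And>f. (\<And>m. f m \<in> weight_space V m) \<Longrightarrow> finite {m. f m \<noteq> 0} \<Longrightarrow>
    Sum_any f = v \<Longrightarrow> weight_component V m v = f m"
proof -
  let ?P = "\<lambda>f. (\<forall>m. f m \<in> weight_space V m) \<and> finite {m. f m \<noteq> 0} \<and> Sum_any f = v"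
  have "v \<in> V.span (\<Union>n. weight_space V n)" by (simp add: span_weight_spaces)
  then obtain f where f: "\<And>m. f m \<in> weight_space V m" "finite {m. f m \<noteq> 0}" "v = Sum_any f"
    by (rule V.span_Union_decompose[OF subspace_weight_space]) blast
  have eq: "(THE f. ?P f) = g" if "?P g" for g
    by (rule the_equality[of ?P, OF that]) (use that weight_decomposition_unique in blast)
  have "weight_component V m v = f m" for m
    unfolding weight_component_def by (subst eq[of f]) (use f in auto)
  with f show "weight_component V m v \<in> weight_space V m"
    "finite {m. weight_component V m v \<noteq> 0}" "Sum_any (\<lambda>m. weight_component V m v) = v" by auto
  show "weight_component V m v = g m" if "\<And>m. g m \<in> weight_space V m" "finite {m. g m \<noteq> 0}"
    "Sum_any g = v" for g
    unfolding weight_component_def by (subst eq[of g]) (use that in auto)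
qed

lemma weight_component_add:
  "weight_component V m (u + v) = weight_component V m u + weight_component V m v"
proof (rule weight_component_eqI)
  let ?f = "\<lambda>m. weight_component V m u" and ?g = "\<lambda>m. weight_component V m v"
  show "?f m + ?g m \<in> weight_space V m" for m
    by (intro V.subspace_add[OF subspace_weight_space] weight_component)
  show "finite {m. ?f m + ?g m \<noteq> 0}"
    by (rule finite_subset[OF _ finite_UnI[OF weight_component(2)[of u] weight_component(2)[of v]]]) auto
  show "Sum_any (\<lambda>m. ?f m + ?g m) = u + v"
    by (simp add: Sum_any.distrib weight_component)
qed

lemma weight_component_scale: "weight_component V m (vscl V c v) = vscl V c (weight_component V m v)"
proof (rule weight_component_eqI)
  let ?f = "\<lambda>m. weight_component V m v"
  interpret vector_space_pair "vscl V" "vscl V" ..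
  show "vscl V c (?f m) \<in> weight_space V m" for m
    by (intro V.subspace_scale[OF subspace_weight_space] weight_component)
  show "finite {m. vscl V c (?f m) \<noteq> 0}"
    by (rule finite_subset[OF _ weight_component(2)[of v]]) auto
  have "linear_on (vscl V) (vscl V) UNIV (vscl V c)"
    by (auto simp: linear_on_def V.scale_right_distrib mult.commute)
  from linear_on_Sum_any_finite[OF this V.subspace_UNIV UNIV_I weight_component(2)[of v]]
  show "Sum_any (\<lambda>m. vscl V c (?f m)) = vscl V c v"
    unfolding weight_component(3) by (rule sym)
qed

lemma weight_component_homogeneous:
  assumes "v \<in> weight_space V n"
  shows "weight_component V m v = (if m = n then v else 0)"
proof (rule weight_component_eqI)
  show "(if m = n then v else 0) \<in> weight_space V m" for m
    using assms V.subspace_0[OF subspace_weight_space] by auto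
  show "finite {m. (if m = n then v else 0) \<noteq> 0}"
    by (rule finite_subset[of _ "{n}"]) auto
  show "Sum_any (\<lambda>m. if m = n then v else 0) = v"
    by (subst Sum_any.expand_superset[of "{n}"]) auto
qed

lemma countable_spanning_set:
  obtains C where "countable C" "V.span C = UNIV"
proof -
  have "fin_dim (vscl V) (weight_space V n)" for n
    using finite_dimensional_weight_space[of n]
      finite_dimensional_iff_fin_dim[OF V.vector_space_axioms subspace_weight_space[of n]] by simp
  then have "\<exists>B. finite B \<and> B \<subseteq> weight_space V n \<and> weight_space V n \<subseteq> V.span B" for n
    by (rule V.fin_dim_basis) blast
  then obtain B where B: "\<And>n. finite (B n)" "\<And>n. B n \<subseteq> weight_space V n"
    "\<And>n. weight_space V n \<subseteq> V.span (B n)" by metis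
  have "(\<Union>n. weight_space V n) \<subseteq> V.span (\<Union>n. B n)"
    using B(3) V.span_mono[of "B _" "\<Union>n. B n"] by blast
  then have "V.span (\<Union>n. B n) = UNIV"
    using V.span_minimal[OF _ V.subspace_span] span_weight_spaces by blast
  moreover have "countable (\<Union>n. B n)"
    using B(1) by (simp add: countable_finite)
  ultimately show thesis by (intro that)
qed

end

locale vertex_module = vertex_algebra V for V :: "('v::ab_group_add, 'y) va_data_scheme" +
  fixes W :: "('v, 'w::ab_group_add, 'z) vmod_data_scheme"
  assumes lower_bounded: "lower_bounded_gen_module V W"
begin

sublocale W: vector_space "scl W"
  using lower_bounded by (simp add: lower_bounded_gen_module_def)

sublocale VW: vector_space_pair "vscl V" "scl W" ..

sublocale WW: vector_space_pair "scl W" "scl W" ..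

lemma subspace_car: "W.subspace (car W)"
  and operator_L0: "operator_on W (mL0 W)"
  and operator_Lm1: "operator_on W (mLm1 W)"
  and operator_Y: "operator_on W (mY W v k)"
  and linear_Y: "w \<in> car W \<Longrightarrow> Vector_Spaces.linear (vscl V) (scl W) (\<lambda>v. mY W v k w)"
  and span_gen_weight_spaces: "W.span (\<Union>n. gen_weight_space W n) = car W"
  and gen_weight_bounded: "\<exists>B::real. \<forall>n. Re n < B \<longrightarrow> gen_weight_space W n = {0}"
  and lower_truncation: "w \<in> car W \<Longrightarrow> \<exists>K. \<forall>k\<ge>K. mY W v k w = 0"
  and Y_vac: "w \<in> car W \<Longrightarrow> mY W (vac V) k w = (if k = -1 then w else 0)"
  and jacobi: "w \<in> car W \<Longrightarrow> jacobi_identity (vY V) (scl W) (mY W) u v w"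
  and L0_Y_commutator: "w \<in> car W \<Longrightarrow> mL0 W (mY W v k w) - mY W v k (mL0 W w) =
    scl W (of_int (- k - 1)) (mY W v k w) + mY W (vL0 V v) k w"
  and Lm1_Y_commutator: "w \<in> car W \<Longrightarrow>
    mLm1 W (mY W v k w) - mY W v k (mLm1 W w) = mY W (vLm1 V v) k w"
  and Lm1_derivative: "w \<in> car W \<Longrightarrow> mY W (vLm1 V v) k w = scl W (of_int (- k)) (mY W v (k - 1) w)"
  and L0_Lm1_commutator: "w \<in> car W \<Longrightarrow> mL0 W (mLm1 W w) - mLm1 W (mL0 W w) = mLm1 W w"
  using lower_bounded by (simp_all add: lower_bounded_gen_module_def)

lemma linear_on_L0: "linear_on (scl W) (scl W) (car W) (mL0 W)"
  and L0_closed: "w \<in> car W \<Longrightarrow> mL0 W w \<in> car W"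
  using operator_L0 by (auto simp: operator_on_def linear_on_def)

lemma linear_on_Lm1: "linear_on (scl W) (scl W) (car W) (mLm1 W)"
  and Lm1_closed: "w \<in> car W \<Longrightarrow> mLm1 W w \<in> car W"
  using operator_Lm1 by (auto simp: operator_on_def linear_on_def)

lemma linear_on_Y: "linear_on (scl W) (scl W) (car W) (mY W v k)"
  and Y_closed: "w \<in> car W \<Longrightarrow> mY W v k w \<in> car W"
  using operator_Y by (auto simp: operator_on_def linear_on_def)

lemma car_zero: "0 \<in> car W"
  by (rule W.subspace_0[OF subspace_car])

lemma L0_image: "mL0 W ` car W \<subseteq> car W"
  using L0_closed by blast

lemma L0_zero: "mL0 W 0 = 0" and Y_zero: "mY W v k 0 = 0"
  using WW.linear_on_zero[OF _ subspace_car] linear_on_L0 linear_on_Y by blast+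

lemma Y_zero_left: "w \<in> car W \<Longrightarrow> mY W 0 k w = 0"
  by (rule VW.linear_0[OF linear_Y])

lemma gen_weight_space_eq: "gen_weight_space W n = gen_eigenspace (scl W) (car W) (mL0 W) {0} n"
proof -
  have "shift_by (scl W) (mL0 W) n = (\<lambda>x. mL0 W x - scl W n x)"
    by (simp add: shift_by_def fun_eq_iff)
  then show ?thesis
    by (simp add: gen_weight_space_def gen_eigenspace_def)
qed

definition eigenspace :: "complex \<Rightarrow> 'w set" where
  "eigenspace a = {w \<in> car W. mL0 W w = scl W a w}"

lemma subspace_eigenspace: "W.subspace (eigenspace a)"
  by (rule W.subspaceI)
    (auto simp: eigenspace_def car_zero L0_zero linear_on_add[OF linear_on_L0]
      linear_on_scale[OF linear_on_L0] W.scale_right_distrib mult.commute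
      intro: W.subspace_add[OF subspace_car] W.subspace_scale[OF subspace_car])

lemma eigenspace_subset: "eigenspace a \<subseteq> car W"
  by (auto simp: eigenspace_def)

lemma eigenspace_subset_gen: "eigenspace a \<subseteq> gen_weight_space W a"
proof
  fix w assume "w \<in> eigenspace a"
  then show "w \<in> gen_weight_space W a"
    unfolding gen_weight_space_eq
    by (auto simp: gen_eigenspace_def eigenspace_def shift_by_def intro!: exI[of _ "Suc 0"])
qed

text \<open>Taking \<open>F = {0}\<close> leaves no correction term, so the sum of the
  \<open>G b\<close> contains in weight \<open>a\<close> nothing beyond \<open>G a\<close>. Choosing
  \<open>G\<close> small in a single weight is how the weights of cyclic submodules are read off
  later.\<close>

lemma gen_weight_component:
  assumes G: "\<And>b. W.subspace (G b)" "\<And>b. G b \<subseteq> gen_weight_space W b"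
    and x: "x \<in> gen_weight_space W a" "x \<in> W.span (\<Union>b. G b)"
  shows "x \<in> G a"
proof -
  have "\<exists>y\<in>G a. x - y \<in> {0}"
    by (rule W.gen_eigenspace_component[OF linear_on_L0 L0_image subspace_car])
      (use assms car_zero L0_zero in \<open>auto simp: gen_weight_space_eq\<close>)
  then show ?thesis by auto
qed

lemma Y_eigenspace:
  assumes "v \<in> weight_space V m" "w \<in> eigenspace a"
  shows "mY W v k w \<in> eigenspace (a + of_int (m - k - 1))"
proof -
  have w: "w \<in> car W" "mL0 W w = scl W a w" using assms(2) by (auto simp: eigenspace_def)
  have v: "vL0 V v = vscl V (of_int m) v" using assms(1) by (simp add: weight_space_def)
  have "mL0 W (mY W v k w) = mY W v k (mL0 W w) +
      (scl W (of_int (- k - 1)) (mY W v k w) + mY W (vL0 V v) k w)"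
    using L0_Y_commutator[OF w(1), of v k] by (simp add: algebra_simps)
  also have "\<dots> = scl W (a + of_int (m - k - 1)) (mY W v k w)"
    by (simp add: w(2) linear_on_scale[OF linear_on_Y w(1)] v VW.linear_scale[OF linear_Y[OF w(1)]]
      W.scale_left_distrib W.scale_left_diff_distrib)
  finally show ?thesis using Y_closed[OF w(1)] by (simp add: eigenspace_def)
qed

lemma Lm1_eigenspace:
  assumes "w \<in> eigenspace a"
  shows "mLm1 W w \<in> eigenspace (a + 1)"
proof -
  have w: "w \<in> car W" "mL0 W w = scl W a w" using assms by (auto simp: eigenspace_def)
  have "mL0 W (mLm1 W w) = mLm1 W (mL0 W w) + mLm1 W w"
    using L0_Lm1_commutator[OF w(1)] by (simp add: algebra_simps)
  then show ?thesis
    using Lm1_closed[OF w(1)]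
    by (simp add: eigenspace_def w(2) linear_on_scale[OF linear_on_Lm1 w(1)] W.scale_left_distrib)
qed

text \<open>In the Jacobi identity with \<open>m = Ku\<close> the second sum on the left vanishes,
  because \<open>u\<close> acts first on \<open>w\<close> there with index at least
  \<open>Ku\<close>, and the right side consists of single modes on \<open>w\<close>. On the left,
  the terms other than the desired one have a larger inner index, so a descending induction on
  \<open>q\<close> applies; it starts where \<open>v\<close> annihilates \<open>w\<close>.\<close>

lemma mode_mode_in_span:
  assumes w: "w \<in> car W"
  shows "mY W u p (mY W v q w) \<in> W.span {mY W v' k w | v' k. True}" (is "_ \<in> ?S")
proof -
  obtain Ku where Ku: "\<And>k. k \<ge> Ku \<Longrightarrow> mY W u k w = 0" using lower_truncation[OF w] by blast
  obtain Kv where Kv: "\<And>k. k \<ge> Kv \<Longrightarrow> mY W v k w = 0" using lower_truncation[OF w] by blast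
  have sub: "W.subspace ?S" by simp
  have "mY W u p (mY W v q w) \<in> ?S" if "Kv - int d \<le> q" for d p q
    using that
  proof (induction d arbitrary: p q rule: less_induct)
    case (less d)
    show ?case
    proof (cases "d = 0")
      case True
      then show ?thesis using Kv[of q] less.prems by (simp add: Y_zero W.span_zero)
    next
      case False
      \<comment> \<open>With this \<open>l\<close> and \<open>m = Ku\<close>, the term
        \<open>i = 0\<close> of the first sum is exactly the product of modes in question, with
        coefficient 1.\<close>
      let ?l = "p - Ku"
      let ?f = "\<lambda>i::nat. scl W ((-1) ^ i * (of_int ?l gchoose i))
         (mY W u (Ku + ?l - int i) (mY W v (q + int i) w))"
      let ?g = "\<lambda>i::nat. scl W (of_int Ku gchoose i) (mY W (vY V u (?l + int i) v) (Ku + q - int i) w)"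
      have "Sum_any ?f - scl W ((-1) powi ?l) (Sum_any (\<lambda>i::nat. scl W ((-1) ^ i * (of_int ?l gchoose i))
         (mY W v (q + ?l - int i) (mY W u (Ku + int i) w)))) = Sum_any ?g"
        using jacobi[OF w, of u v] unfolding jacobi_identity_def by blast
      then have eq: "Sum_any ?f = Sum_any ?g"
        by (simp add: Ku Y_zero)
      have g: "Sum_any ?g \<in> ?S"
        by (intro W.subspace_Sum_any[OF sub] W.span_scale W.span_base) blast
      \<comment> \<open>\<open>Suc\<close> keeps the index 0 inside the range even when
        \<open>Kv \<le> q\<close>, so that \<open>?f 0\<close> can be split off.\<close>
      define N where "N = Suc (nat (Kv - q))"
      have "{i. ?f i \<noteq> 0} \<subseteq> {..<N}"
      proof (rule subsetI, rule ccontr)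
        fix i assume i: "i \<in> {i. ?f i \<noteq> 0}" "i \<notin> {..<N}"
        then have "q + int i \<ge> Kv" by (simp add: N_def)
        with i(1) show False by (simp add: Kv Y_zero)
      qed
      then have "Sum_any ?f = sum ?f {..<N}" by (intro Sum_any.expand_superset) auto
      also have "{..<N} = insert 0 {1..<N}" by (auto simp: N_def)
      also have "sum ?f (insert 0 {1..<N}) = ?f 0 + sum ?f {1..<N}" by simp
      finally have "?f 0 = Sum_any ?g - sum ?f {1..<N}"
        unfolding eq by (rule add_implies_diff[OF sym])
      moreover have "sum ?f {1..<N} \<in> ?S"
      proof (intro W.subspace_sum[OF sub] W.span_scale)
        fix i assume "i \<in> {1..<N}"
        with less.prems False show "mY W u (Ku + ?l - int i) (mY W v (q + int i) w) \<in> ?S"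
          by (intro less.IH[of "d - 1"]) auto
      qed
      ultimately have "?f 0 \<in> ?S" using W.span_diff[OF g] by simp
      then show ?thesis by simp
    qed
  qed
  from this[of "nat (Kv - q)"] show ?thesis by simp
qed

lemma residue_summable:
  "w \<in> car W \<Longrightarrow> finite {n. mY W (weight_component V n v) (f n) w \<noteq> 0}"
  by (rule finite_subset[OF _ weight_component(2)[of v]]) (auto simp: Y_zero_left)

lemma linear_residue_action:
  assumes w: "w \<in> car W"
  shows "Vector_Spaces.linear (vscl V) (scl W) (\<lambda>v. residue_action V W k l v w)"
proof -
  have add: "residue_action V W k l (u + v) w = residue_action V W k l u w + residue_action V W k l v w" for u v
    unfolding residue_action_def weight_component_add VW.linear_add[OF linear_Y[OF w]]
    by (rule Sum_any.distrib) (rule residue_summable[OF w])+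
  have lin: "linear_on (scl W) (scl W) UNIV (scl W c)" for c
    by (auto simp: linear_on_def W.scale_right_distrib mult.commute)
  moreover have "residue_action V W k l (vscl V c v) w = scl W c (residue_action V W k l v w)" for c v
    unfolding residue_action_def weight_component_scale VW.linear_scale[OF linear_Y[OF w]]
    by (rule WW.linear_on_Sum_any_finite[OF lin W.subspace_UNIV, symmetric])
      (simp_all add: residue_summable[OF w])
  ultimately show ?thesis
    by (simp add: add Vector_Spaces.linear_iff V.vector_space_axioms W.vector_space_axioms)
qed

lemma linear_on_residue_action:
  "linear_on (scl W) (scl W) (car W) (residue_action V W k l v)"
proof -
  have "residue_action V W k l v (w + w') = residue_action V W k l v w + residue_action V W k l v w'"
    if "w \<in> car W" "w' \<in> car W" for w w'
    unfolding residue_action_def linear_on_add[OF linear_on_Y that]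
    by (rule Sum_any.distrib) (rule residue_summable[OF that(1)] residue_summable[OF that(2)])+
  moreover have "residue_action V W k l v (scl W c w) = scl W c (residue_action V W k l v w)"
    if w: "w \<in> car W" for c w
  proof -
    have lin: "linear_on (scl W) (scl W) UNIV (scl W c)"
      by (auto simp: linear_on_def W.scale_right_distrib mult.commute)
    show ?thesis
      unfolding residue_action_def linear_on_scale[OF linear_on_Y w]
      by (rule WW.linear_on_Sum_any_finite[OF lin W.subspace_UNIV, symmetric])
        (simp_all add: residue_summable[OF w])
  qed
  ultimately show ?thesis by (auto simp: linear_on_def)
qed

text \<open>This mode has degree \<open>k - l\<close>; with \<open>k = 0\<close> and
  \<open>l = n\<close> it is the operator o(v) of degree \<open>-n\<close>.\<close>

lemma residue_action_homogeneous:
  assumes "v \<in> weight_space V n" "w \<in> car W"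
  shows "residue_action V W k l v w = mY W v (n + int l - int k - 1) w"
  unfolding residue_action_def weight_component_homogeneous[OF assms(1)]
  by (subst Sum_any.expand_superset[of "{n}"]) (auto simp: Y_zero_left[OF assms(2)])

lemma residue_action_in:
  assumes "W.subspace S"
    and "\<And>n. mY W (weight_component V n v) (n + int l - int k - 1) w \<in> S"
  shows "residue_action V W k l v w \<in> S"
  unfolding residue_action_def by (rule W.subspace_Sum_any[OF assms])

lemma residue_action_eigenspace:
  assumes "w \<in> eigenspace a"
  shows "residue_action V W k l v w \<in> eigenspace (a + of_int (int k - int l))"
proof (rule residue_action_in[OF subspace_eigenspace])
  fix n
  show "mY W (weight_component V n v) (n + int l - int k - 1) w \<in> eigenspace (a + of_int (int k - int l))"
    using Y_eigenspace[OF weight_component(1)[of n v] assms, of "n + int l - int k - 1"]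
    by (simp add: algebra_simps)
qed

lemma subspace_Omega: "W.subspace (Omega V W n)"
  by (cases "n < 0", simp add: Omega_def)
    (rule W.subspaceI; auto simp: Omega_def car_zero Y_zero linear_on_add[OF linear_on_Y]
      linear_on_scale[OF linear_on_Y] intro: W.subspace_add[OF subspace_car] W.subspace_scale[OF subspace_car])

lemma Omega_subset: "Omega V W n \<subseteq> car W"
  using car_zero by (auto simp: Omega_def)

end

lemma finite_support_nat: "(\<And>i. i \<ge> N \<Longrightarrow> f i = 0) \<Longrightarrow> finite {i::nat. f i \<noteq> 0}"
  by (rule finite_subset[of _ "{..<N}"]) (auto simp: not_less[symmetric])

section \<open>Submodules and homomorphic images\<close>

context vertex_module
begin

lemma subspace_gen_weight_space: "W.subspace (gen_weight_space W n)"
proof (rule W.subspaceI)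
  note D = W.linear_on_funpow[OF W.linear_on_shift_by[OF linear_on_L0 L0_image subspace_car]]
  show "0 \<in> gen_weight_space W n"
    using car_zero by (auto simp: gen_weight_space_eq gen_eigenspace_def intro!: exI[of _ 0])
  show "scl W c x \<in> gen_weight_space W n" if "x \<in> gen_weight_space W n" for c x
    using that linear_on_scale[OF D(1)] W.subspace_scale[OF subspace_car]
    by (fastforce simp: gen_weight_space_eq gen_eigenspace_def)
  show "x + y \<in> gen_weight_space W n" if that': "x \<in> gen_weight_space W n" "y \<in> gen_weight_space W n" for x y
  proof -
    let ?D = "shift_by (scl W) (mL0 W) n"
    obtain p q where xy: "x \<in> car W" "y \<in> car W" and "(?D ^^ p) x = 0" "(?D ^^ q) y = 0"
      using that' by (auto simp: gen_weight_space_eq gen_eigenspace_def)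
    moreover have "(?D ^^ k) 0 = 0" for k by (rule WW.linear_on_zero[OF D(1) subspace_car])
    ultimately have "(?D ^^ (q + p)) x = 0" "(?D ^^ (p + q)) y = 0"
      by (simp_all add: funpow_add)
    then have "(?D ^^ (p + q)) (x + y) = 0"
      by (simp add: linear_on_add[OF D(1) xy] add.commute[of q p])
    then show ?thesis
      using W.subspace_add[OF subspace_car xy] by (auto simp: gen_weight_space_eq gen_eigenspace_def)
  qed
qed

lemma gen_weight_space_subset: "gen_weight_space W n \<subseteq> car W"
  by (auto simp: gen_weight_space_def)

section \<open>Images of modules under intertwining linear maps\<close>

context
  fixes W' :: "('v, 'x::ab_group_add, 'z2) vmod_data_scheme" and \<phi> :: "'w \<Rightarrow> 'x"
  assumes vs: "vector_space (scl W')" and lin: "linear_on (scl W) (scl W') (car W) \<phi>"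
    and car: "car W' = \<phi> ` car W"
    and Y: "\<And>v k w. w \<in> car W \<Longrightarrow> mY W' v k (\<phi> w) = \<phi> (mY W v k w)"
    and L0: "\<And>w. w \<in> car W \<Longrightarrow> mL0 W' (\<phi> w) = \<phi> (mL0 W w)"
    and Lm1: "\<And>w. w \<in> car W \<Longrightarrow> mLm1 W' (\<phi> w) = \<phi> (mLm1 W w)"
begin

text \<open>The inclusion of the left side in the right one is the substantial one. If
  \<open>\<phi> w\<close> has generalized weight \<open>n\<close>, then \<open>w\<close> has it
  modulo the kernel of \<open>\<phi>\<close>, and \<open>gen_eigenspace_component\<close> corrects
  \<open>w\<close> by a kernel element to a true generalized weight vector with the same
  image.\<close>

lemma gen_weight_space_image: "gen_weight_space W' n = \<phi> ` gen_weight_space W n"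
proof -
  interpret W': vector_space "scl W'" by (rule vs)
  interpret WW': vector_space_pair "scl W" "scl W'" ..
  note D = W.linear_on_funpow[OF W.linear_on_shift_by[OF linear_on_L0 L0_image subspace_car]]
  let ?D = "shift_by (scl W) (mL0 W) n" and ?D' = "\<lambda>x. mL0 W' x - scl W' n x"
  let ?F = "{w \<in> car W. \<phi> w \<in> {0}}"
  have \<phi>0: "\<phi> 0 = 0" by (rule WW'.linear_on_zero[OF lin subspace_car])
  have D_in: "(?D ^^ p) w \<in> car W" if "w \<in> car W" for p w
    using D(2) that by blast
  have "?D' (\<phi> w) = \<phi> (?D w)" if "w \<in> car W" for w
    by (simp add: shift_by_def that L0 WW'.linear_on_diff[OF lin subspace_car]
      linear_on_scale[OF lin] L0_closed W.subspace_scale[OF subspace_car])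
  then have pow: "(?D' ^^ p) (\<phi> w) = \<phi> ((?D ^^ p) w)" if "w \<in> car W" for p w
    using that D_in by (induction p) auto
  have F: "W.subspace ?F"
    by (rule WW'.linear_on_kernel_subspace[OF lin subspace_car W'.subspace_single_0])
  have "\<phi> w \<in> \<phi> ` gen_weight_space W n" if w: "w \<in> car W" "(?D' ^^ p) (\<phi> w) = 0" for w p
  proof -
    have "(?D ^^ p) w \<in> ?F"
      using w pow[of w p] D_in[of w p] by simp
    then have "w \<in> gen_eigenspace (scl W) (car W) (mL0 W) ?F n"
      using w(1) by (auto simp: gen_eigenspace_def)
    moreover have "mL0 W ` ?F \<subseteq> ?F"
      using L0_closed L0[symmetric] L0[OF car_zero] by (auto simp: L0_zero \<phi>0)
    moreover have "gen_weight_space W b \<subseteq> gen_eigenspace (scl W) (car W) (mL0 W) ?F b" for b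
      unfolding gen_weight_space_eq by (rule gen_eigenspace_mono) (simp add: car_zero \<phi>0)
    ultimately obtain y where "y \<in> gen_weight_space W n" "w - y \<in> ?F"
      using W.gen_eigenspace_component[OF linear_on_L0 L0_image subspace_car F, of "gen_weight_space W" w n]
        subspace_gen_weight_space span_gen_weight_spaces w(1) by blast
    moreover from this have "\<phi> w = \<phi> y"
      using WW'.linear_on_diff[OF lin subspace_car w(1), of y] gen_weight_space_subset by auto
    ultimately show ?thesis by blast
  qed
  moreover have "\<phi> w \<in> gen_weight_space W' n" if w: "w \<in> gen_weight_space W n" for w
  proof -
    have "w \<in> car W" using w gen_weight_space_subset by blast
    moreover obtain p where "(?D ^^ p) w = 0"
      using w by (auto simp: gen_weight_space_eq gen_eigenspace_def)
    ultimately have "(?D' ^^ p) (\<phi> w) = 0" using pow \<phi>0 by simp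
    then show ?thesis using \<open>w \<in> car W\<close> by (auto simp: gen_weight_space_def car)
  qed
  moreover have "\<exists>w\<in>car W. \<exists>p. x = \<phi> w \<and> (?D' ^^ p) (\<phi> w) = 0" if "x \<in> gen_weight_space W' n" for x
    using that unfolding gen_weight_space_def car by blast
  ultimately show ?thesis by blast
qed

text \<open>Injectivity is not assumed: the result serves both the coordinate embedding into
  sequences and the projection that models a quotient.\<close>

lemma lower_bounded_gen_module_image: "lower_bounded_gen_module V W'"
proof -
  interpret W': vector_space "scl W'" by (rule vs)
  interpret WW': vector_space_pair "scl W" "scl W'" ..
  have \<phi>0: "\<phi> 0 = 0" by (rule WW'.linear_on_zero[OF lin subspace_car])
  have \<phi>_in: "\<phi> w \<in> \<phi> ` car W" if "w \<in> car W" for w using that by blast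
  have op: "operator_on W' f'" if "\<And>w. w \<in> car W \<Longrightarrow> f' (\<phi> w) = \<phi> (f w)"
    "linear_on (scl W) (scl W) (car W) f" "\<And>w. w \<in> car W \<Longrightarrow> f w \<in> car W" for f f'
    using that lin W.subspace_add[OF subspace_car] W.subspace_scale[OF subspace_car]
    by (auto simp: operator_on_def car linear_on_def simp flip: linear_on_add[OF lin] linear_on_scale[OF lin])
  have sub': "W'.subspace (car W')"
    unfolding car by (rule WW'.linear_on_image_subspace[OF lin subspace_car])
  have "\<phi> w \<in> W'.span (\<Union>n. gen_weight_space W' n)" if "w \<in> car W" for w
    by (rule WW'.linear_on_span_image[OF lin subspace_car _ W'.subspace_span, of "\<Union>n. gen_weight_space W n"])
      (use that gen_weight_space_subset span_gen_weight_spaces in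
        \<open>auto simp: gen_weight_space_image intro: W'.span_base\<close>)
  moreover have "W'.span (\<Union>n. gen_weight_space W' n) \<subseteq> car W'"
    by (rule W'.span_minimal[OF _ sub']) (auto simp: gen_weight_space_def)
  ultimately have span': "W'.span (\<Union>n. gen_weight_space W' n) = car W'"
    by (auto simp: car)
  have bound: "\<exists>B::real. \<forall>n. Re n < B \<longrightarrow> gen_weight_space W' n = {0}"
  proof -
    obtain B where "\<forall>n. Re n < B \<longrightarrow> gen_weight_space W n = {0}" using gen_weight_bounded by blast
    then show ?thesis by (intro exI[of _ B]) (simp add: gen_weight_space_image \<phi>0)
  qed
  have jac: "jacobi_identity (vY V) (scl W') (mY W') u v (\<phi> w)" if w: "w \<in> car W" for u v w
    unfolding jacobi_identity_def
  proof (intro allI)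
    fix l m n
    have comp: "\<phi> (scl W c (mY W u' k w)) = scl W' c (mY W' u' k (\<phi> w))" if "w \<in> car W" for c u' k w
      using that by (simp add: Y linear_on_scale[OF lin] Y_closed)
    have sc: "scl W c (mY W u' k w) \<in> car W" if "w \<in> car W" for c u' k w
      using that W.subspace_scale[OF subspace_car] Y_closed by blast
    \<comment> \<open>The three truncation bounds make the supports of the Jacobi sums finite. As
      \<open>\<phi>\<close> may annihilate terms, this finiteness is what lets it commute with
      \<open>Sum_any\<close>.\<close>
    obtain Ku where Ku: "\<And>k. k \<ge> Ku \<Longrightarrow> mY W u k w = 0" using lower_truncation[OF w] by blast
    obtain Kv where Kv: "\<And>k. k \<ge> Kv \<Longrightarrow> mY W v k w = 0" using lower_truncation[OF w] by blast
    obtain K where K: "\<And>k. k \<ge> K \<Longrightarrow> vY V u k v = 0" using lower_truncation_V by blast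
    define f where "f i = scl W ((-1) ^ i * (of_int l gchoose i))
         (mY W u (m + l - int i) (mY W v (n + int i) w))" for i
    define g where "g i = scl W ((-1) ^ i * (of_int l gchoose i))
         (mY W v (n + l - int i) (mY W u (m + int i) w))" for i
    define h where "h i = scl W (of_int m gchoose i) (mY W (vY V u (l + int i) v) (m + n - int i) w)" for i
    have car: "f i \<in> car W" "g i \<in> car W" "h i \<in> car W" for i
      by (simp_all add: f_def g_def h_def sc Y_closed w)
    have "finite {i. f i \<noteq> 0}"
      by (rule finite_support_nat[of "nat (Kv - n)"]) (simp add: f_def Kv Y_zero)
    from WW'.linear_on_Sum_any_finite[OF lin subspace_car car(1) this]
    have f: "Sum_any (\<lambda>i. \<phi> (f i)) = \<phi> (Sum_any f)" by simp
    have "finite {i. g i \<noteq> 0}"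
      by (rule finite_support_nat[of "nat (Ku - m)"]) (simp add: g_def Ku Y_zero)
    from WW'.linear_on_Sum_any_finite[OF lin subspace_car car(2) this]
    have g: "Sum_any (\<lambda>i. \<phi> (g i)) = \<phi> (Sum_any g)" by simp
    have "finite {i. h i \<noteq> 0}"
      by (rule finite_support_nat[of "nat (K - l)"]) (simp add: h_def K Y_zero_left w)
    from WW'.linear_on_Sum_any_finite[OF lin subspace_car car(3) this]
    have h: "Sum_any (\<lambda>i. \<phi> (h i)) = \<phi> (Sum_any h)" by simp
    have f': "\<phi> (f i) = scl W' ((-1) ^ i * (of_int l gchoose i))
         (mY W' u (m + l - int i) (mY W' v (n + int i) (\<phi> w)))" for i
      by (simp add: f_def comp Y w Y_closed)
    have g': "\<phi> (g i) = scl W' ((-1) ^ i * (of_int l gchoose i))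
         (mY W' v (n + l - int i) (mY W' u (m + int i) (\<phi> w)))" for i
      by (simp add: g_def comp Y w Y_closed)
    have h': "\<phi> (h i) =
        scl W' (of_int m gchoose i) (mY W' (vY V u (l + int i) v) (m + n - int i) (\<phi> w))" for i
      by (simp add: h_def comp w)
    have sum_car: "Sum_any f \<in> car W" "Sum_any g \<in> car W"
      by (simp_all add: W.subspace_Sum_any[OF subspace_car] car)
    have "Sum_any f - scl W ((-1) powi l) (Sum_any g) = Sum_any h"
      using jacobi[OF w, of u v] unfolding jacobi_identity_def f_def g_def h_def by blast
    then have "\<phi> (Sum_any f) - scl W' ((-1) powi l) (\<phi> (Sum_any g)) = \<phi> (Sum_any h)"
      by (metis WW'.linear_on_diff[OF lin subspace_car sum_car(1)] W.subspace_scale[OF subspace_car sum_car(2)]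
        linear_on_scale[OF lin sum_car(2)])
    then show "Sum_any (\<lambda>i::nat. scl W' ((-1) ^ i * (of_int l gchoose i))
         (mY W' u (m + l - int i) (mY W' v (n + int i) (\<phi> w))))
       - scl W' ((-1) powi l) (Sum_any (\<lambda>i::nat. scl W' ((-1) ^ i * (of_int l gchoose i))
         (mY W' v (n + l - int i) (mY W' u (m + int i) (\<phi> w)))))
       = Sum_any (\<lambda>i::nat. scl W' (of_int m gchoose i) (mY W' (vY V u (l + int i) v) (m + n - int i) (\<phi> w)))"
      unfolding f'[symmetric] g'[symmetric] h'[symmetric] f g h .
  qed
  have linY: "Vector_Spaces.linear (vscl V) (scl W') (\<lambda>v. mY W' v k (\<phi> w))" if w: "w \<in> car W" for k w
    by (simp add: Vector_Spaces.linear_iff V.vector_space_axioms W'.vector_space_axioms Y w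
      VW.linear_add[OF linear_Y[OF w]] VW.linear_scale[OF linear_Y[OF w]]
      linear_on_add[OF lin] linear_on_scale[OF lin] Y_closed)
  have trunc: "\<exists>K. \<forall>k\<ge>K. mY W' v k (\<phi> w) = 0" if "w \<in> car W" for v w
    using lower_truncation[OF that, of v] by (metis Y \<phi>0 that)
  have sc: "scl W c w \<in> car W" if "w \<in> car W" for c w
    using that W.subspace_scale[OF subspace_car] by blast
  have neg: "\<phi> (- w) = - \<phi> w" if "w \<in> car W" for w
    using WW'.linear_on_diff[OF lin subspace_car car_zero that] by (simp add: \<phi>0)
  note \<phi>_rules = neg linear_on_add[OF lin, symmetric] linear_on_scale[OF lin, symmetric]
    WW'.linear_on_diff[OF lin subspace_car, symmetric]
  show ?thesis
    unfolding lower_bounded_gen_module_def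
    using vs sub' span' bound op[OF L0 linear_on_L0 L0_closed] op[OF Lm1 linear_on_Lm1 Lm1_closed]
      op[OF Y linear_on_Y Y_closed]
    by (intro conjI)
      (simp_all add: car linY trunc jac, simp_all add: Y L0 Lm1 Y_closed L0_closed Lm1_closed Y_vac \<phi>0 \<phi>_rules sc
      L0_Y_commutator Lm1_Y_commutator Lm1_derivative L0_Lm1_commutator)
qed

end

text \<open>Only the grading needs an argument: weight components of a vector of \<open>F\<close>
  could leave \<open>F\<close>. Modulo \<open>F\<close> they sum to zero and belong to different
  eigenvalues, so independence puts each of them into \<open>F\<close>.\<close>

lemma lower_bounded_gen_module_restrict:
  assumes F: "W.subspace F" "F \<subseteq> car W" and Y: "\<And>v k w. w \<in> F \<Longrightarrow> mY W v k w \<in> F"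
    and L0: "\<And>w. w \<in> F \<Longrightarrow> mL0 W w \<in> F" and Lm1: "\<And>w. w \<in> F \<Longrightarrow> mLm1 W w \<in> F"
  shows "lower_bounded_gen_module V (W\<lparr>car := F\<rparr>)"
proof -
  let ?W = "W\<lparr>car := F\<rparr>"
  have gen: "gen_weight_space ?W n = gen_weight_space W n \<inter> F" for n
    using F(2) by (auto simp: gen_weight_space_def)
  have "x \<in> W.span (\<Union>n. gen_weight_space ?W n)" if x: "x \<in> F" for x
  proof -
    have "x \<in> W.span (\<Union>n. gen_weight_space W n)"
      using x F(2) span_gen_weight_spaces by blast
    then obtain f where f: "\<And>n. f n \<in> gen_weight_space W n" "finite {n. f n \<noteq> 0}" "x = Sum_any f"
      by (rule W.span_Union_decompose[OF subspace_gen_weight_space]) blast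
    have "f n \<in> F" for n
    proof (cases "f n = 0")
      case False
      have gen_F: "f n \<in> gen_eigenspace (scl W) (car W) (mL0 W) F n" for n
        using f(1)[of n] gen_eigenspace_mono[of "{0}" F] W.subspace_0[OF F(1)]
        unfolding gen_weight_space_eq by blast
      have "sum f {n. f n \<noteq> 0} \<in> F"
        using x f(3) by (simp add: Sum_any.expand_set)
      then show ?thesis
        using False L0
        by (intro W.gen_eigenspaces_independent_mod[OF linear_on_L0 L0_image subspace_car F _ f(2) gen_F])
          auto
    qed (simp add: W.subspace_0[OF F(1)])
    then show ?thesis
      unfolding f(3) using f(1)
      by (intro W.subspace_Sum_any W.subspace_span W.span_base) (auto simp: gen)
  qed
  moreover have "W.span (\<Union>n. gen_weight_space ?W n) \<subseteq> F"
    by (rule W.span_minimal[OF _ F(1)]) (auto simp: gen)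
  ultimately have span: "W.span (\<Union>n. gen_weight_space ?W n) = F" by blast
  have bound: "\<exists>B::real. \<forall>n. Re n < B \<longrightarrow> gen_weight_space ?W n = {0}"
    using gen_weight_bounded W.subspace_0[OF F(1)] by (auto simp: gen)
  have op: "operator_on ?W f" if "operator_on W f" "\<And>w. w \<in> F \<Longrightarrow> f w \<in> F" for f
    using that F(2) by (simp add: operator_on_def subset_iff)
  have F': "w \<in> car W" if "w \<in> F" for w using F(2) that by blast
  show ?thesis
    unfolding lower_bounded_gen_module_def
    using W.vector_space_axioms F(1) span bound op[OF operator_L0 L0] op[OF operator_Lm1 Lm1]
      op[OF operator_Y Y]
    by (intro conjI)
      (simp_all add: F' linear_Y lower_truncation jacobi Y_vac
      L0_Y_commutator Lm1_Y_commutator Lm1_derivative L0_Lm1_commutator)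
qed

end

section \<open>The spaces \<open>Q\<^sup>\<infinity>(V)\<close> and \<open>A\<^sup>N(V)\<close>\<close>

context vertex_module
begin

lemma Omega_mono: "Omega V W (int n - 1) \<subseteq> Omega V W (int n)"
  using W.subspace_0[OF subspace_Omega[of "int n"]]
  by (cases "n = 0") (auto simp: Omega_def)

text \<open>\<open>theta_Gr\<close> sums only over degrees where \<open>g l\<close> is not the zero
  coset, so vectors of Omega_{l-1}(W) are not tested. One direction evaluates on families
  concentrated in a single degree; the other uses that the whole coset of a vector outside
  Omega_{l-1}(W) stays outside it.\<close>

lemma ker_theta_Gr_iff:
  "M \<in> ker_theta_Gr V W \<longleftrightarrow> M \<in> U_inf \<and> (\<forall>k l. \<forall>w \<in> Omega V W (int l) - Omega V W (int l - 1).
     residue_action V W k l (M k l) w \<in> Omega V W (int k - 1))"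
proof (intro iffI conjI allI ballI)
  assume M: "M \<in> ker_theta_Gr V W"
  then show "M \<in> U_inf" by (simp add: ker_theta_Gr_def)
  fix k l w assume w: "w \<in> Omega V W (int l) - Omega V W (int l - 1)"
  define g where "g j = (if j = l then w +o Omega V W (int l - 1) else Omega V W (int j - 1))" for j :: nat
  have supp: "{j. g j \<noteq> Omega V W (int j - 1)} = {l}"
    using w W.coset_eq_self_iff[OF subspace_Omega] by (auto simp: g_def)
  have "g j \<in> Gr_comp V W j" for j
  proof (cases "j = l")
    case True
    then show ?thesis using w by (auto simp: g_def Gr_comp_def cosets_def)
  next
    case False
    then have "g j = 0 +o Omega V W (int j - 1)"
      by (simp add: g_def W.coset_zero)
    then show ?thesis
      using W.subspace_0[OF subspace_Omega] unfolding Gr_comp_def cosets_def by blast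
  qed
  then have "g \<in> Gr V W" by (simp add: Gr_def supp)
  with M have "theta_Gr V W M g = (\<lambda>k. Omega V W (int k - 1))" by (simp add: ker_theta_Gr_def)
  from fun_cong[OF this, of k] have "residue_action V W k l (M k l) ` g l + Omega V W (int k - 1) = Omega V W (int k - 1)"
    by (simp add: theta_Gr_def supp)
  moreover have "w \<in> g l" using W.coset_self[OF subspace_Omega] by (simp add: g_def)
  then have "residue_action V W k l (M k l) w + 0 \<in>
      residue_action V W k l (M k l) ` g l + Omega V W (int k - 1)"
    by (intro set_plus_intro imageI W.subspace_0[OF subspace_Omega])
  ultimately show "residue_action V W k l (M k l) w \<in> Omega V W (int k - 1)" by simp
next
  assume M: "M \<in> U_inf \<and> (\<forall>k l. \<forall>w \<in> Omega V W (int l) - Omega V W (int l - 1).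
     residue_action V W k l (M k l) w \<in> Omega V W (int k - 1))"
  have "theta_Gr V W M g k = Omega V W (int k - 1)" if g: "g \<in> Gr V W" for g k
    unfolding theta_Gr_def
  proof (rule W.subspace_sum_set_plus[OF subspace_Omega])
    fix l assume l: "l \<in> {l. g l \<noteq> Omega V W (int l - 1)}"
    obtain w where w: "w \<in> Omega V W (int l)" "g l = w +o Omega V W (int l - 1)"
      using g by (auto simp: Gr_def Gr_comp_def cosets_def)
    have "w \<notin> Omega V W (int l - 1)"
      using l w W.coset_eq_self_iff[OF subspace_Omega] by auto
    have "x \<in> Omega V W (int l) - Omega V W (int l - 1)" if x: "x \<in> g l" for x
    proof -
      obtain d where d: "x = w + d" "d \<in> Omega V W (int l - 1)"
        using x w(2) by (auto simp: elt_set_plus_def)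
      then have "x \<in> Omega V W (int l)"
        using W.subspace_add[OF subspace_Omega w(1)] Omega_mono by blast
      moreover have "w = x - d" using d(1) by simp
      then have "x \<notin> Omega V W (int l - 1)"
        using W.subspace_diff[OF subspace_Omega _ d(2)] \<open>w \<notin> _\<close> by blast
      ultimately show ?thesis by blast
    qed
    moreover have "w \<in> g l" using W.coset_self[OF subspace_Omega] by (simp add: w(2))
    ultimately show "residue_action V W k l (M k l) ` g l \<subseteq> Omega V W (int k - 1) \<and>
        residue_action V W k l (M k l) ` g l \<noteq> {}"
      using M by blast
  qed
  with M show "M \<in> ker_theta_Gr V W" by (auto simp: ker_theta_Gr_def)
qed

text \<open>The modes involved have degree \<open>-n\<close>, which is below
  \<open>-(n - 1)\<close>. This settles the vectors that \<open>ker_theta_Gr_iff\<close> leaves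
  untested.\<close>

lemma residue_action_Omega_lower:
  assumes "w \<in> Omega V W (int n - 1)"
  shows "residue_action V W 0 n v w = 0"
proof -
  have "residue_action V W 0 n v w \<in> {0}"
  proof (rule residue_action_in[OF W.subspace_single_0])
    fix m
    show "mY W (weight_component V m v) (m + int n - int 0 - 1) w \<in> {0}"
      using assms weight_component(1)[of m v] by (auto simp: Omega_def Y_zero split: if_splits)
  qed
  then show ?thesis by simp
qed

text \<open>The module is transported to sequences, where \<open>Q_inf\<close> is defined.\<close>

lemma Q_inf_annihilates:
  assumes G: "countable G" "W.span G = car W" and M: "M \<in> Q_inf V" and w: "w \<in> Omega V W (int n)"
  shows "residue_action V W 0 n (M 0 n) w = 0"
proof (cases "w \<in> Omega V W (int n - 1)")
  case True
  then show ?thesis by (rule residue_action_Omega_lower)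
next
  case False
  let ?s = "\<lambda>c (f :: nat \<Rightarrow> complex) n. c * f n"
  obtain \<phi> :: "'w \<Rightarrow> nat \<Rightarrow> complex" where \<phi>: "linear_on (scl W) ?s (car W) \<phi>"
    and inj0: "\<And>x. x \<in> car W \<Longrightarrow> \<phi> x = 0 \<Longrightarrow> x = 0"
    by (rule W.countable_span_embedding[OF G(1)]) (simp add: G(2))
  interpret S: vector_space ?s
    by unfold_locales (auto simp: fun_eq_iff algebra_simps)
  interpret WS: vector_space_pair "scl W" ?s ..
  have inj: "inj_on \<phi> (car W)"
  proof (rule inj_onI)
    fix x y assume xy: "x \<in> car W" "y \<in> car W" "\<phi> x = \<phi> y"
    then show "x = y"
      using inj0[of "x - y"] WS.linear_on_diff[OF \<phi> subspace_car, of x y] W.subspace_diff[OF subspace_car]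
      by simp
  qed
  define \<psi> where "\<psi> = inv_into (car W) \<phi>"
  have \<psi>: "\<psi> (\<phi> x) = x" if "x \<in> car W" for x
    by (simp add: \<psi>_def inj that)
  define W' :: "('v, nat \<Rightarrow> complex) vmod_data" where
    "W' = \<lparr>car = \<phi> ` car W, scl = ?s, mY = (\<lambda>v k x. \<phi> (mY W v k (\<psi> x))),
      mL0 = (\<lambda>x. \<phi> (mL0 W (\<psi> x))), mLm1 = (\<lambda>x. \<phi> (mLm1 W (\<psi> x)))\<rparr>"
  have mod: "lower_bounded_gen_module V W'"
    by (rule lower_bounded_gen_module_image[of W' \<phi>]) (simp_all add: W'_def S.vector_space_axioms \<phi> \<psi>)
  interpret W': vertex_module V W' by unfold_locales (rule mod)
  have \<phi>0: "\<phi> 0 = 0" by (rule WS.linear_on_zero[OF \<phi> subspace_car])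
  have Y': "mY W' v k (\<phi> x) = \<phi> (mY W v k x)" if "x \<in> car W" for v k x
    by (simp add: W'_def \<psi> that)
  have zero_iff: "\<phi> x = 0 \<longleftrightarrow> x = 0" if "x \<in> car W" for x
    using inj0[OF that] \<phi>0 by blast
  have Omega: "\<phi> x \<in> Omega V W' k \<longleftrightarrow> x \<in> Omega V W k" if "x \<in> car W" for x k
  proof -
    have "\<phi> x \<in> car W'" using that by (simp add: W'_def)
    with that show ?thesis
      by (auto simp: Omega_def Y' zero_iff Y_closed)
  qed
  have wc: "w \<in> car W" using w Omega_subset by blast
  have "\<phi> w \<in> Omega V W' (int n) - Omega V W' (int n - 1)"
    using w False Omega[OF wc] by simp
  moreover have "M \<in> ker_theta_Gr V W'"
    using M mod by (simp add: Q_inf_def)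
  ultimately have "residue_action V W' 0 n (M 0 n) (\<phi> w) \<in> Omega V W' (int 0 - 1)"
    using W'.ker_theta_Gr_iff by blast
  \<comment> \<open>Row 0 pays off here: the target Omega_{-1} is \<open>{0}\<close>, so a statement
    about cosets becomes vanishing of a vector.\<close>
  then have "residue_action V W' 0 n (M 0 n) (\<phi> w) = 0"
    by (simp add: Omega_def)
  moreover have "residue_action V W' 0 n (M 0 n) (\<phi> w) = \<phi> (residue_action V W 0 n (M 0 n) w)"
    unfolding residue_action_def Y'[OF wc]
    by (rule WS.linear_on_Sum_any[OF \<phi> subspace_car, symmetric]) (auto simp: Y_closed wc inj0)
  ultimately show ?thesis
    using inj0 residue_action_in[OF subspace_car Y_closed[OF wc]] by simp
qed

end

section \<open>Matrices over V as a vector space and generators of its coset spaces\<close>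

context vertex_algebra
begin

abbreviation matrix_scale :: "complex \<Rightarrow> (nat \<Rightarrow> nat \<Rightarrow> 'v) \<Rightarrow> nat \<Rightarrow> nat \<Rightarrow> 'v" where
  "matrix_scale c M \<equiv> \<lambda>k l. vscl V c (M k l)"

lemma vector_space_matrix: "vector_space matrix_scale"
  by unfold_locales (auto simp: fun_eq_iff V.scale_right_distrib V.scale_left_distrib)

sublocale M: vector_space matrix_scale
  by (rule vector_space_matrix)

lemma subspace_U_inf: "M.subspace U_inf"
proof (rule M.subspaceI)
  show "(0 :: nat \<Rightarrow> nat \<Rightarrow> 'v) \<in> U_inf" by (simp add: U_inf_def)
  show "x + y \<in> U_inf" if "x \<in> U_inf" "y \<in> U_inf" for x y :: "nat \<Rightarrow> nat \<Rightarrow> 'v"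
  proof -
    have "finite {k. (x + y) k l \<noteq> 0}" for l
      by (rule finite_subset[of _ "{k. x k l \<noteq> 0} \<union> {k. y k l \<noteq> 0}"])
        (use that in \<open>auto simp: U_inf_def\<close>)
    then show ?thesis by (simp add: U_inf_def)
  qed
  show "matrix_scale c x \<in> U_inf" if "x \<in> U_inf" for c x
  proof -
    have "finite {k. vscl V c (x k l) \<noteq> 0}" for l
      by (rule finite_subset[of _ "{k. x k l \<noteq> 0}"]) (use that in \<open>auto simp: U_inf_def\<close>)
    then show ?thesis by (simp add: U_inf_def)
  qed
qed

lemma subspace_U_fin: "M.subspace (U_fin N)"
proof (rule M.subspaceI)
  show "(0 :: nat \<Rightarrow> nat \<Rightarrow> 'v) \<in> U_fin N" using M.subspace_0[OF subspace_U_inf] by (simp add: U_fin_def)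
  show "x + y \<in> U_fin N" if "x \<in> U_fin N" "y \<in> U_fin N"
    for x y :: "nat \<Rightarrow> nat \<Rightarrow> 'v"
    using that M.subspace_add[OF subspace_U_inf] by (auto simp: U_fin_def)
  show "matrix_scale c x \<in> U_fin N" if "x \<in> U_fin N" for c x
    using that M.subspace_scale[OF subspace_U_inf] by (auto simp: U_fin_def)
qed

text \<open>Linearity in the matrix is checked on vectors through \<open>ker_theta_Gr_iff\<close>,
  since \<open>theta_Gr\<close> takes values in families of cosets.\<close>

lemma subspace_ker_theta_Gr:
  assumes "lower_bounded_gen_module V W"
  shows "M.subspace (ker_theta_Gr V W)"
proof -
  interpret W: vertex_module V W by unfold_locales (rule assms)
  have car: "w \<in> car W" if "w \<in> Omega V W l" for w l using that W.Omega_subset by blast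
  note lin = W.linear_residue_action[OF car]
  show ?thesis
  proof (rule M.subspaceI)
    show "0 \<in> ker_theta_Gr V W"
      using M.subspace_0[OF subspace_U_inf] W.W.subspace_0[OF W.subspace_Omega]
      by (auto simp: W.ker_theta_Gr_iff W.VW.linear_0[OF lin])
    show "x + y \<in> ker_theta_Gr V W" if "x \<in> ker_theta_Gr V W" "y \<in> ker_theta_Gr V W" for x y
      using that M.subspace_add[OF subspace_U_inf] W.W.subspace_add[OF W.subspace_Omega]
      by (auto simp: W.ker_theta_Gr_iff W.VW.linear_add[OF lin])
    show "matrix_scale c x \<in> ker_theta_Gr V W" if "x \<in> ker_theta_Gr V W" for c x
      using that M.subspace_scale[OF subspace_U_inf] W.W.subspace_scale[OF W.subspace_Omega]
      by (auto simp: W.ker_theta_Gr_iff W.VW.linear_scale[OF lin])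
  qed
qed

lemma subspace_Q_inf: "M.subspace (Q_inf V)"
  by (rule M.subspaceI)
    (auto simp: Q_inf_def intro: M.subspace_0[OF subspace_U_inf] M.subspace_add[OF subspace_U_inf]
      M.subspace_scale[OF subspace_U_inf] M.subspace_0[OF subspace_ker_theta_Gr]
      M.subspace_add[OF subspace_ker_theta_Gr] M.subspace_scale[OF subspace_ker_theta_Gr])

text \<open>Choose representatives of finitely many generating cosets. The matrices of
  \<open>U_fin N\<close> in the span of these and \<open>Q_inf V\<close> have cosets forming a
  subspace that contains the generators, hence all cosets; equality of cosets then costs only an
  element of \<open>Q_inf V\<close>.\<close>

lemma finite_dimensional_A_alg_spanning:
  assumes "finite_dimensional (A_alg V N)"
  obtains B where "finite B" "U_fin N \<subseteq> M.span (B \<union> Q_inf V)"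
proof -
  let ?Q = "Q_inf V"
  obtain B' where B': "finite B'" "B' \<subseteq> cosets (U_fin N) ?Q"
    "\<And>S. subspace_in (A_alg V N) S \<Longrightarrow> B' \<subseteq> S \<Longrightarrow> S = cosets (U_fin N) ?Q"
    using assms unfolding finite_dimensional_def by (auto simp: A_alg_def)
  obtain r where r: "\<And>X. X \<in> B' \<Longrightarrow> r X \<in> U_fin N \<and> X = r X +o ?Q"
  proof -
    have "\<forall>X\<in>B'. \<exists>x. x \<in> U_fin N \<and> X = x +o ?Q"
      using B'(2) unfolding cosets_def by blast
    from bchoice[OF this] show thesis using that by blast
  qed
  let ?B = "r ` B'"
  let ?S = "U_fin N \<inter> M.span (?B \<union> ?Q)"
  have S: "M.subspace ?S"
    by (intro M.subspace_inter subspace_U_fin M.subspace_span)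
  have lin: "linear_on matrix_scale matrix_scale UNIV (matrix_scale c)" for c
    by (auto simp: linear_on_def fun_eq_iff V.scale_right_distrib mult.commute)
  have "subspace_in (A_alg V N) (cosets ?S ?Q)"
    unfolding subspace_in_def
  proof (intro conjI ballI allI)
    show "cosets ?S ?Q \<noteq> {}" using M.subspace_0[OF S] unfolding cosets_def by blast
    show "cosets ?S ?Q \<subseteq> car (A_alg V N)" by (auto simp: cosets_def A_alg_def)
    show "X + Y \<in> cosets ?S ?Q" if XY: "X \<in> cosets ?S ?Q" "Y \<in> cosets ?S ?Q" for X Y
    proof -
      obtain x y where "x \<in> ?S" "X = x +o ?Q" "y \<in> ?S" "Y = y +o ?Q"
        using XY unfolding cosets_def by blast
      moreover from this have "x + y \<in> ?S" using M.subspace_add[OF S] by blast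
      ultimately show ?thesis
        unfolding cosets_def using M.coset_plus[OF subspace_Q_inf] by blast
    qed
    show "scl (A_alg V N) c X \<in> cosets ?S ?Q" if X: "X \<in> cosets ?S ?Q" for c X
    proof -
      obtain x where x: "x \<in> ?S" "X = x +o ?Q"
        using X unfolding cosets_def by blast
      have "scl (A_alg V N) c X = matrix_scale c x +o ?Q"
        unfolding A_alg_def x(2) cspace.simps
        by (rule M.on_cosets_coset[OF lin M.subspace_UNIV subspace_Q_inf])
          (auto intro: M.subspace_scale[OF subspace_Q_inf])
      then show ?thesis
        unfolding cosets_def using M.subspace_scale[OF S x(1)] by blast
    qed
  qed
  moreover have "B' \<subseteq> cosets ?S ?Q"
  proof
    fix X assume X: "X \<in> B'"
    then have "r X \<in> ?S" using r[OF X] by (auto intro: M.span_base)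
    then show "X \<in> cosets ?S ?Q" using r[OF X] unfolding cosets_def by blast
  qed
  ultimately have eq: "cosets ?S ?Q = cosets (U_fin N) ?Q" by (rule B'(3))
  have "x \<in> M.span (?B \<union> ?Q)" if "x \<in> U_fin N" for x
  proof -
    have "x +o ?Q \<in> cosets ?S ?Q" using that unfolding eq unfolding cosets_def by blast
    then obtain y where y: "y \<in> ?S" "x +o ?Q = y +o ?Q" unfolding cosets_def by blast
    then have "x - y \<in> M.span (?B \<union> ?Q)"
      using M.coset_eq_iff[OF subspace_Q_inf] by (auto intro: M.span_base)
    then show ?thesis
      using M.span_add[of "x - y" _ y] y(1) by simp
  qed
  then show thesis using that[of ?B] B'(1) by blast
qed

end

context vertex_module
begin

text \<open>For fixed \<open>w\<close> in Omega_n(W), letting the (0,n) entry of a matrix act on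
  \<open>w\<close> is linear and kills \<open>Q_inf V\<close>. The matrix whose only entry is
  \<open>v\<close> at (0,n) belongs to \<open>U_fin n\<close>, so it is enough to keep the (0,n)
  entries of finitely many matrices. These are chosen before \<open>w\<close>.\<close>

lemma finitely_many_residue_actions:
  assumes A: "finite_dimensional (A_alg V n)" and G: "countable G" "W.span G = car W"
  obtains U where "finite U"
    "\<And>v w. w \<in> Omega V W (int n) \<Longrightarrow>
      residue_action V W 0 n v w \<in> W.span ((\<lambda>u. residue_action V W 0 n u w) ` U)"
proof -
  obtain B where B: "finite B" "U_fin n \<subseteq> M.span (B \<union> Q_inf V)"
    by (rule finite_dimensional_A_alg_spanning[OF A])
  let ?U = "(\<lambda>M. M 0 n) ` B"
  have "residue_action V W 0 n v w \<in> W.span ((\<lambda>u. residue_action V W 0 n u w) ` ?U)" (is "_ \<in> ?S")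
    if w: "w \<in> Omega V W (int n)" for v w
  proof -
    have wc: "w \<in> car W" using w Omega_subset by blast
    interpret MW: vector_space_pair matrix_scale "scl W" ..
    note lin = linear_residue_action[OF wc, of 0 n]
    have f: "linear_on matrix_scale (scl W) UNIV (\<lambda>M. residue_action V W 0 n (M 0 n) w)"
      by (simp add: linear_on_def VW.linear_add[OF lin] VW.linear_scale[OF lin])
    define E where "E = (\<lambda>(k::nat) l. if k = 0 \<and> l = n then v else 0)"
    have "{k. E k l \<noteq> 0} \<subseteq> {0}" for l by (auto simp: E_def)
    then have "E \<in> U_fin n"
      by (auto simp: U_fin_def U_inf_def intro: finite_subset) (auto simp: E_def)
    then have "E \<in> M.span (B \<union> Q_inf V)" using B(2) by blast
    then have "residue_action V W 0 n (E 0 n) w \<in> ?S"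
      by (rule MW.linear_on_span_image[OF f M.subspace_UNIV subset_UNIV W.subspace_span, rotated])
        (auto simp: Q_inf_annihilates[OF G _ w] W.span_zero intro: W.span_base)
    then show ?thesis by (simp add: E_def)
  qed
  then show thesis using that[of ?U] B(1) by blast
qed

end

section \<open>Moebius modules\<close>

locale moebius_module =
  fixes V :: "('v::ab_group_add, 'y) mva_data_scheme"
    and W :: "('v, 'w::ab_group_add, 'z) mvmod_data_scheme"
  assumes moebius_V: "moebius_va V" and moebius_W: "lower_bounded_gen_moebius_module V W"
begin

sublocale vertex_module V W
  using moebius_V moebius_W
  by unfold_locales (simp_all add: moebius_va_def lower_bounded_gen_moebius_module_def)

lemma operator_L1: "operator_on W (mL1 W)"
  and L0_L1_commutator: "w \<in> car W \<Longrightarrow> mL0 W (mL1 W w) - mL1 W (mL0 W w) = - mL1 W w"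
  and L1_Lm1_commutator: "w \<in> car W \<Longrightarrow> mL1 W (mLm1 W w) - mLm1 W (mL1 W w) = scl W 2 (mL0 W w)"
  and L1_Y_commutator: "w \<in> car W \<Longrightarrow> mL1 W (mY W v k w) - mY W v k (mL1 W w) =
    mY W (vL1 V v) k w + scl W 2 (mY W (vL0 V v) (k + 1) w) + mY W (vLm1 V v) (k + 2) w"
  using moebius_W by (simp_all add: lower_bounded_gen_moebius_module_def)

lemma linear_on_L1: "linear_on (scl W) (scl W) (car W) (mL1 W)"
  and L1_closed: "w \<in> car W \<Longrightarrow> mL1 W w \<in> car W"
  using operator_L1 by (auto simp: operator_on_def linear_on_def)

lemma L1_eigenspace:
  assumes "w \<in> eigenspace a"
  shows "mL1 W w \<in> eigenspace (a - 1)"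
proof -
  have w: "w \<in> car W" "mL0 W w = scl W a w" using assms by (auto simp: eigenspace_def)
  have "mL0 W (mL1 W w) = mL1 W (mL0 W w) - mL1 W w"
    using L0_L1_commutator[OF w(1)] by (simp add: algebra_simps)
  then show ?thesis
    using L1_closed[OF w(1)]
    by (simp add: eigenspace_def w(2) linear_on_scale[OF linear_on_L1 w(1)] W.scale_left_diff_distrib)
qed

lemma gen_submodule_iff:
  "gen_submodule W S \<longleftrightarrow> W.subspace S \<and> S \<subseteq> car W \<and>
     (\<forall>w\<in>S. (\<forall>v k. mY W v k w \<in> S) \<and> mL0 W w \<in> S \<and> mLm1 W w \<in> S \<and> mL1 W w \<in> S)"
  unfolding gen_submodule_def subspace_in_iff[OF W.vector_space_axioms] by blast

lemma linear_on_Lm1_pow: "linear_on (scl W) (scl W) (car W) (mLm1 W ^^ i)"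
  and Lm1_pow_closed: "w \<in> car W \<Longrightarrow> (mLm1 W ^^ i) w \<in> car W"
  using W.linear_on_funpow[OF linear_on_Lm1] Lm1_closed by blast+

text \<open>V is not assumed to contain a conformal vector, so L(-1) need not be a mode and its
  powers occur separately. Placing them on the left is a normal form reached through the commutator
  of L(-1) with modes.\<close>

definition cyclic_subspace :: "'w \<Rightarrow> 'w set" where
  "cyclic_subspace x = W.span {(mLm1 W ^^ i) (mY W v k x) | i v k. True}"

text \<open>The generators depend linearly on \<open>v\<close>, so \<open>C\<close> can be adapted
  to the purpose: homogeneous elements for weight arguments, a countable set for
  countability.\<close>

lemma cyclic_subspace_minimal:
  assumes x: "x \<in> car W" and C: "V.span C = UNIV" and S: "W.subspace S"
    and gens: "\<And>i v k. v \<in> C \<Longrightarrow> (mLm1 W ^^ i) (mY W v k x) \<in> S"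
  shows "cyclic_subspace x \<subseteq> S"
  unfolding cyclic_subspace_def
proof (rule W.span_minimal[OF _ S], safe)
  fix i v k
  have "linear_on (vscl V) (scl W) UNIV (\<lambda>v. (mLm1 W ^^ i) (mY W v k x))"
    by (simp add: linear_on_def VW.linear_add[OF linear_Y[OF x]] VW.linear_scale[OF linear_Y[OF x]]
      linear_on_add[OF linear_on_Lm1_pow] linear_on_scale[OF linear_on_Lm1_pow] Y_closed x)
  then show "(mLm1 W ^^ i) (mY W v k x) \<in> S"
    by (rule VW.linear_on_span_image[OF _ V.subspace_UNIV subset_UNIV S, of _ C]) (simp_all add: gens C)
qed

text \<open>Modes pass L(-1) by the commutator formula and two modes merge by
  \<open>mode_mode_in_span\<close>. L(0) and L(1) are moved to the right until they reach
  \<open>x\<close>: there L(0) acts by a scalar, and \<open>mL1 W x = 0\<close> removes the term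
  with a mode applied to L(1)x, which could otherwise leave the span.\<close>

lemma cyclic_subspace_submodule:
  assumes x: "x \<in> eigenspace a" and L1x: "mL1 W x = 0"
  shows "gen_submodule W (cyclic_subspace x)"
proof -
  let ?T = "cyclic_subspace x" and ?G = "{(mLm1 W ^^ i) (mY W v k x) | i v k. True}"
  have xc: "x \<in> car W" and L0x: "mL0 W x = scl W a x" using x by (auto simp: eigenspace_def)
  have T: "W.subspace ?T" by (simp add: cyclic_subspace_def)
  have gen: "(mLm1 W ^^ i) (mY W v k x) \<in> ?T" for i v k
    unfolding cyclic_subspace_def by (rule W.span_base) blast
  have mode: "mY W v k x \<in> ?T" for v k using gen[of 0] by simp
  have G: "?G \<subseteq> car W" using Lm1_pow_closed Y_closed[OF xc] by blast
  then have Tc: "?T \<subseteq> car W"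
    unfolding cyclic_subspace_def by (rule W.span_minimal[OF _ subspace_car])
  have invariant: "f w \<in> ?T" if "linear_on (scl W) (scl W) (car W) f"
    "\<And>i v k. f ((mLm1 W ^^ i) (mY W v k x)) \<in> ?T" "w \<in> ?T" for f w
    by (rule WW.linear_on_span_image[OF that(1) subspace_car G T _ that(3)[unfolded cyclic_subspace_def]])
      (use that(2) in blast)
  have Lm1: "mLm1 W w \<in> ?T" if "w \<in> ?T" for w
    by (rule invariant[OF linear_on_Lm1 _ that]) (use gen[of "Suc _"] in simp)
  have Lm1Y: "mLm1 W (mY W v k w) = mY W v k (mLm1 W w) + mY W (vLm1 V v) k w" if "w \<in> car W" for v k w
    using Lm1_Y_commutator[OF that, of v k] by (simp add: algebra_simps)
  have L0Lm1: "mL0 W (mLm1 W w) = mLm1 W (mL0 W w) + mLm1 W w" if "w \<in> car W" for w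
    using L0_Lm1_commutator[OF that] by (simp add: algebra_simps)
  have L1Lm1: "mL1 W (mLm1 W w) = mLm1 W (mL1 W w) + scl W 2 (mL0 W w)" if "w \<in> car W" for w
    using L1_Lm1_commutator[OF that] by (simp add: algebra_simps)
  have c: "(mLm1 W ^^ i) (mY W v k x) \<in> car W" for i v k
    using gen Tc by blast
  have Y0: "mY W u j (mY W v k x) \<in> ?T" for u j v k
  proof -
    have "W.span {mY W v' k x |v' k. True} \<subseteq> ?T"
      by (rule W.span_minimal[OF _ T]) (use mode in blast)
    then show ?thesis using mode_mode_in_span[OF xc] by blast
  qed
  have Yi: "mY W u j ((mLm1 W ^^ i) (mY W v k x)) \<in> ?T" for u j i v k
  proof (induction i arbitrary: u j)
    case 0 then show ?case by (simp add: Y0)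
  next
    case (Suc i)
    let ?w = "(mLm1 W ^^ i) (mY W v k x)"
    have "mY W u j (mLm1 W ?w) = mLm1 W (mY W u j ?w) - mY W (vLm1 V u) j ?w"
      by (simp add: Lm1Y[OF c])
    then show ?case using W.subspace_diff[OF T Lm1[OF Suc] Suc] by simp
  qed
  have L0i: "mL0 W ((mLm1 W ^^ i) (mY W v k x)) \<in> ?T" for i v k
  proof (induction i)
    case 0
    have "mL0 W (mY W v k x) = mY W v k (mL0 W x) +
        (scl W (of_int (- k - 1)) (mY W v k x) + mY W (vL0 V v) k x)"
      using L0_Y_commutator[OF xc, of v k] by (simp add: algebra_simps)
    also have "\<dots> \<in> ?T"
      unfolding L0x linear_on_scale[OF linear_on_Y xc]
      by (intro W.subspace_add[OF T] W.subspace_scale[OF T] mode)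
    finally show ?case by simp
  next
    case (Suc i)
    then show ?case
      by (simp add: L0Lm1 c W.subspace_add[OF T] Lm1 gen)
  qed
  have L1i: "mL1 W ((mLm1 W ^^ i) (mY W v k x)) \<in> ?T" for i v k
  proof (induction i)
    case 0
    have "mL1 W (mY W v k x) = mY W v k (mL1 W x) +
        (mY W (vL1 V v) k x + scl W 2 (mY W (vL0 V v) (k + 1) x) + mY W (vLm1 V v) (k + 2) x)"
      using L1_Y_commutator[OF xc, of v k] by (simp add: algebra_simps)
    also have "\<dots> \<in> ?T"
      unfolding L1x Y_zero
      by (intro W.subspace_add[OF T] W.subspace_scale[OF T] mode W.subspace_0[OF T])
    finally show ?case by simp
  next
    case (Suc i)
    then show ?case
      by (simp add: L1Lm1 c W.subspace_add[OF T] W.subspace_scale[OF T] Lm1 L0i)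
  qed
  show ?thesis
    unfolding gen_submodule_iff
    using T Tc Lm1 invariant[OF linear_on_Y Yi] invariant[OF linear_on_L0 L0i]
      invariant[OF linear_on_L1 L1i] by blast
qed

lemma span_eigenspaces_submodule: "gen_submodule W (W.span (\<Union>a. eigenspace a))" (is "gen_submodule W ?S")
proof -
  have base: "w \<in> ?S" if "w \<in> eigenspace a" for w a
    using that by (intro W.span_base) blast
  have invariant: "f w \<in> ?S" if "linear_on (scl W) (scl W) (car W) f"
    "\<And>w a. w \<in> eigenspace a \<Longrightarrow> f w \<in> ?S" "w \<in> ?S" for f w
    by (rule WW.linear_on_span_image[OF that(1) subspace_car _ W.subspace_span _ that(3)])
      (use that(2) eigenspace_subset in blast)+
  have "mY W v k w \<in> ?S" if w: "w \<in> eigenspace a" for v k w a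
  proof -
    have wc: "w \<in> car W" using w eigenspace_subset by blast
    have "linear_on (vscl V) (scl W) UNIV (\<lambda>v. mY W v k w)"
      by (simp add: linear_on_def VW.linear_add[OF linear_Y[OF wc]] VW.linear_scale[OF linear_Y[OF wc]])
    then show ?thesis
      by (rule VW.linear_on_span_image[OF _ V.subspace_UNIV subset_UNIV W.subspace_span,
            of _ "\<Union>n. weight_space V n"])
        (use w in \<open>auto simp: span_weight_spaces intro: base[OF Y_eigenspace]\<close>)
  qed
  then have Y: "mY W v k w \<in> ?S" if "w \<in> ?S" for v k w
    by (rule invariant[OF linear_on_Y _ that])
  have L0: "mL0 W w \<in> ?S" if "w \<in> ?S" for w
  proof (rule invariant[OF linear_on_L0 _ that])
    fix w a assume w: "w \<in> eigenspace a"
    then have "mL0 W w = scl W a w" by (simp add: eigenspace_def)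
    then show "mL0 W w \<in> ?S" using W.span_scale[OF base[OF w]] by simp
  qed
  have Lm1: "mLm1 W w \<in> ?S" if "w \<in> ?S" for w
    by (rule invariant[OF linear_on_Lm1 _ that]) (rule base[OF Lm1_eigenspace])
  have L1: "mL1 W w \<in> ?S" if "w \<in> ?S" for w
    by (rule invariant[OF linear_on_L1 _ that]) (rule base[OF L1_eigenspace])
  have "?S \<subseteq> car W"
    by (rule W.span_minimal[OF _ subspace_car]) (use eigenspace_subset in blast)
  then show ?thesis
    unfolding gen_submodule_iff using Y L0 Lm1 L1 by simp
qed

end

section \<open>Weights and lowest weight vectors of irreducible modules\<close>

locale irreducible_moebius_module = moebius_module V W
  for V :: "('v::ab_group_add, 'y) mva_data_scheme"
    and W :: "('v, 'w::ab_group_add, 'z) mvmod_data_scheme" +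
  assumes irreducible: "irreducible_gen_module W"
begin

lemma submodule_cases: "gen_submodule W S \<Longrightarrow> S = {0} \<or> S = car W"
  using irreducible W.subspace_is_singleton_iff
  unfolding irreducible_gen_module_def gen_submodule_iff by blast

lemma car_nontrivial: "car W \<noteq> {0}"
  using irreducible unfolding irreducible_gen_module_def is_singleton_def by blast

lemma span_eigenspaces: "W.span (\<Union>a. eigenspace a) = car W"
proof -
  have "\<exists>n. gen_weight_space W n \<noteq> {0}"
  proof (rule ccontr)
    assume "\<nexists>n. gen_weight_space W n \<noteq> {0}"
    then have "(\<Union>n. gen_weight_space W n) = {0}" by auto
    then show False using span_gen_weight_spaces car_nontrivial by simp
  qed
  then obtain n u where u: "u \<in> gen_weight_space W n" "u \<noteq> 0"
    using W.subspace_0[OF subspace_gen_weight_space] by blast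
  let ?D = "shift_by (scl W) (mL0 W) n"
  have uc: "u \<in> car W" and "\<exists>p. (?D ^^ p) u = 0"
    using u(1) by (auto simp: gen_weight_space_eq gen_eigenspace_def)
  \<comment> \<open>With the least exponent that kills \<open>u\<close>, the last nonzero iterate is
    a genuine eigenvector.\<close>
  then obtain p where p: "(?D ^^ p) u = 0" "\<And>q. q < p \<Longrightarrow> (?D ^^ q) u \<noteq> 0"
    using exists_least_iff[of "\<lambda>p. (?D ^^ p) u = 0"] by metis
  obtain q where q: "p = Suc q" using p(1) u(2) by (cases p) auto
  have D_in: "(?D ^^ q) u \<in> car W"
    using uc W.linear_on_funpow(2)[OF W.linear_on_shift_by[OF linear_on_L0 L0_image subspace_car]]
    by blast
  have "(?D ^^ q) u \<in> eigenspace n"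
    using p(1) by (simp add: q eigenspace_def shift_by_def D_in)
  moreover have "(?D ^^ q) u \<noteq> 0" by (rule p(2)) (simp add: q)
  ultimately have "W.span (\<Union>a. eigenspace a) \<noteq> {0}"
    using W.span_base[of "(?D ^^ q) u" "\<Union>a. eigenspace a"] by blast
  then show ?thesis using submodule_cases[OF span_eigenspaces_submodule] by blast
qed

lemma gen_weight_space_eq_eigenspace: "gen_weight_space W a = eigenspace a"
proof
  show "gen_weight_space W a \<subseteq> eigenspace a"
    using gen_weight_component[OF subspace_eigenspace eigenspace_subset_gen]
      span_eigenspaces gen_weight_space_subset by blast
qed (rule eigenspace_subset_gen)

text \<open>Descend from an occurring weight in integer steps; the lower bound on real parts makes
  the number of steps bounded, and its greatest value gives \<open>h\<close>. Weights outside h + Z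
  are excluded only afterwards, by \<open>weights\<close>.\<close>

lemma lowest_weight_exists:
  obtains h where "eigenspace h \<noteq> {0}" "\<And>j::int. j < 0 \<Longrightarrow> eigenspace (h + of_int j) = {0}"
proof -
  obtain a where a: "eigenspace a \<noteq> {0}"
  proof (rule ccontr)
    assume "\<not> thesis"
    then have "(\<Union>a. eigenspace a) = {0}" using that by auto
    then show False using span_eigenspaces car_nontrivial by simp
  qed
  obtain B where B: "\<And>n. Re n < B \<Longrightarrow> gen_weight_space W n = {0}"
    using gen_weight_bounded by blast
  let ?P = "\<lambda>k::nat. eigenspace (a - of_nat k) \<noteq> {0}"
  have bound: "k \<le> nat \<lceil>Re a - B\<rceil>" if "?P k" for k
  proof (rule ccontr)
    assume "\<not> k \<le> nat \<lceil>Re a - B\<rceil>"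
    then have "Re (a - of_nat k) < B" by simp linarith
    then show False using B that by (simp add: gen_weight_space_eq_eigenspace)
  qed
  have P0: "?P 0" using a by simp
  define m where "m = (GREATEST k. ?P k)"
  have m: "?P m" unfolding m_def
    by (rule GreatestI_nat[of ?P 0 "nat \<lceil>Re a - B\<rceil>"]) (use P0 bound in auto)
  have le: "k \<le> m" if "?P k" for k
    unfolding m_def by (rule Greatest_le_nat[of ?P k "nat \<lceil>Re a - B\<rceil>"]) (use that bound in auto)
  have "eigenspace (a - of_nat m + of_int j) = {0}" if "j < 0" for j
  proof -
    have "a - of_nat m + of_int j = a - of_nat (m + nat (- j))"
      using that by simp
    moreover have "\<not> m + nat (- j) \<le> m" using that by simp
    ultimately show ?thesis using le[of "m + nat (- j)"] by argo
  qed
  with m show thesis by (rule that)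
qed

context
  fixes h assumes h: "eigenspace h \<noteq> {0}" "\<And>j::int. j < 0 \<Longrightarrow> eigenspace (h + of_int j) = {0}"
begin

lemma cyclic_subspace_eq_car:
  assumes "x \<in> eigenspace a" "mL1 W x = 0" "x \<noteq> 0"
  shows "cyclic_subspace x = car W"
proof -
  have "x = mY W (vac V) (-1) x" using assms(1) by (simp add: eigenspace_def Y_vac)
  then have "x \<in> cyclic_subspace x"
    unfolding cyclic_subspace_def by (intro W.span_base) (metis (mono_tags, lifting) CollectI funpow_0)
  then show ?thesis
    using submodule_cases[OF cyclic_subspace_submodule[OF assms(1,2)]] assms(3) by blast
qed

lemma generator_eigenspace:
  assumes "x \<in> eigenspace (h + of_int n)" "v \<in> weight_space V m"
  shows "(mLm1 W ^^ i) (mY W v k x) \<in> eigenspace (h + of_int (n + m - k - 1 + int i))"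
proof (induction i)
  case 0
  then show ?case using Y_eigenspace[OF assms(2,1), of k] by (simp add: algebra_simps)
next
  case (Suc i)
  then show ?case using Lm1_eigenspace[OF Suc] by (simp add: algebra_simps)
qed

lemma lowest_weight_space_covered:
  assumes x: "x \<in> eigenspace (h + of_nat n)" "mL1 W x = 0" "x \<noteq> 0"
  shows "eigenspace h \<subseteq> range (\<lambda>v. residue_action V W 0 n v x)" (is "_ \<subseteq> ?O")
proof
  fix w assume w: "w \<in> eigenspace h"
  have x': "x \<in> eigenspace (h + of_int (int n))" and xc: "x \<in> car W"
    using x eigenspace_subset by auto
  have "linear_on (vscl V) (scl W) UNIV (\<lambda>v. residue_action V W 0 n v x)"
    by (simp add: linear_on_def VW.linear_add[OF linear_residue_action[OF xc]]
      VW.linear_scale[OF linear_residue_action[OF xc]])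
  then have O: "W.subspace ?O" by (rule VW.linear_on_image_subspace[OF _ V.subspace_UNIV])
  have Oh: "?O \<subseteq> eigenspace h"
    using residue_action_eigenspace[OF x(1), of 0 n] by auto
  let ?G = "\<lambda>b. if b = h then ?O else eigenspace b"
  have "cyclic_subspace x \<subseteq> W.span (\<Union>b. ?G b)"
  proof (rule cyclic_subspace_minimal[OF xc span_weight_spaces W.subspace_span])
    fix i v k assume "v \<in> (\<Union>n. weight_space V n)"
    then obtain m where v: "v \<in> weight_space V m" by blast
    let ?d = "int n + m - k - 1"
    have gen: "(mLm1 W ^^ i) (mY W v k x) \<in> eigenspace (h + of_int (?d + int i))"
      by (rule generator_eigenspace[OF x' v])
    show "(mLm1 W ^^ i) (mY W v k x) \<in> W.span (\<Union>b. ?G b)"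
    proof (cases "?d + int i = 0")
      case False
      then have "h + of_int (?d + int i) \<noteq> h" by (metis add_cancel_left_right of_int_eq_0_iff)
      with gen have "(mLm1 W ^^ i) (mY W v k x) \<in> ?G (h + of_int (?d + int i))" by simp
      then show ?thesis by (intro W.span_base UN_I[OF UNIV_I])
    next
      case True
      show ?thesis
      proof (cases "i = 0")
        case True
        then have "k = m + int n - int 0 - 1" using \<open>?d + int i = 0\<close> by simp
        then have "(mLm1 W ^^ i) (mY W v k x) = residue_action V W 0 n v x"
          using True by (simp add: residue_action_homogeneous[OF v xc])
        then have "(mLm1 W ^^ i) (mY W v k x) \<in> ?G h" by simp
        then show ?thesis by (intro W.span_base UN_I[OF UNIV_I])
      next
        case False
        then have "mY W v k x = 0"
          using generator_eigenspace[OF x' v, of 0 k] h(2)[of ?d] True by auto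
        then have "(mLm1 W ^^ i) (mY W v k x) = 0"
          using WW.linear_on_zero[OF linear_on_Lm1_pow subspace_car] by simp
        then show ?thesis by (simp add: W.span_zero)
      qed
    qed
  qed
  moreover have "w \<in> cyclic_subspace x"
    using cyclic_subspace_eq_car[OF x] w eigenspace_subset by blast
  ultimately have "w \<in> W.span (\<Union>b. ?G b)" by blast
  moreover have "?G b \<subseteq> gen_weight_space W b" for b
    using Oh eigenspace_subset_gen[of b] by auto
  moreover have "W.subspace (?G b)" for b
    using O subspace_eigenspace by simp
  moreover have "w \<in> gen_weight_space W h" using w eigenspace_subset_gen by blast
  ultimately have "w \<in> ?G h" by (intro gen_weight_component[of ?G w h])
  then show "w \<in> ?O" by simp
qed

lemma lowest_weight_vector:
  obtains x where "x \<in> eigenspace h" "x \<noteq> 0" "mL1 W x = 0"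
proof -
  obtain x where x: "x \<in> eigenspace h" "x \<noteq> 0"
    using h(1) W.subspace_0[OF subspace_eigenspace] by blast
  then have "mL1 W x = 0" using L1_eigenspace[OF x(1)] h(2)[of "-1"] by simp
  with x show thesis by (rule that)
qed

text \<open>A lowest weight vector generates W, and all its generators with homogeneous
  \<open>v\<close> have weight in h + Z; the choice of \<open>h\<close> excludes negative
  shifts.\<close>

lemma weights: "eigenspace a \<noteq> {0} \<Longrightarrow> \<exists>n::nat. a = h + of_nat n"
proof -
  assume a: "eigenspace a \<noteq> {0}"
  obtain x where x: "x \<in> eigenspace h" "x \<noteq> 0" "mL1 W x = 0" by (rule lowest_weight_vector)
  have x': "x \<in> eigenspace (h + of_int 0)" and xc: "x \<in> car W"
    using x eigenspace_subset by auto
  let ?G = "\<lambda>b. if \<exists>e::int. b = h + of_int e then eigenspace b else {0}"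
  have "cyclic_subspace x \<subseteq> W.span (\<Union>b. ?G b)"
  proof (rule cyclic_subspace_minimal[OF xc span_weight_spaces W.subspace_span])
    fix i v k assume "v \<in> (\<Union>n. weight_space V n)"
    then obtain m where v: "v \<in> weight_space V m" by blast
    let ?e = "0 + m - k - 1 + int i"
    have "\<exists>e::int. h + of_int ?e = h + of_int e" by blast
    with generator_eigenspace[OF x' v, of i k]
    have "(mLm1 W ^^ i) (mY W v k x) \<in> ?G (h + of_int ?e)" by (simp only: if_True)
    then show "(mLm1 W ^^ i) (mY W v k x) \<in> W.span (\<Union>b. ?G b)"
      by (intro W.span_base UN_I[OF UNIV_I])
  qed
  then have span: "car W \<subseteq> W.span (\<Union>b. ?G b)"
    using cyclic_subspace_eq_car[OF x(1,3,2)] by simp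
  obtain w where w: "w \<in> eigenspace a" "w \<noteq> 0"
    using a W.subspace_0[OF subspace_eigenspace] by blast
  have "?G b \<subseteq> gen_weight_space W b" for b
    using eigenspace_subset_gen[of b] W.subspace_0[OF subspace_gen_weight_space] by auto
  moreover have "W.subspace (?G b)" for b
    using subspace_eigenspace by simp
  ultimately have "w \<in> ?G a"
    using w eigenspace_subset_gen[of a] eigenspace_subset span
    by (intro gen_weight_component[of ?G w a]) blast+
  then obtain e :: int where e: "a = h + of_int e" using w(2) by (auto split: if_splits)
  with a h(2) have "e \<ge> 0" by (meson not_le)
  then show ?thesis using e by (intro exI[of _ "nat e"]) simp
qed

text \<open>Irreducibility makes W cyclic over the countably spanned V. This is what admits W to the
  test by modules of sequences in \<open>Q_inf_annihilates\<close>.\<close>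

lemma countably_spanned:
  obtains G where "countable G" "W.span G = car W"
proof -
  obtain x where x: "x \<in> eigenspace h" "x \<noteq> 0" "mL1 W x = 0" by (rule lowest_weight_vector)
  have xc: "x \<in> car W" using x eigenspace_subset by auto
  obtain C where C: "countable C" "V.span C = UNIV" by (rule countable_spanning_set)
  let ?G = "(\<lambda>(i, v, k). (mLm1 W ^^ i) (mY W v k x)) ` (UNIV \<times> C \<times> UNIV)"
  have "cyclic_subspace x \<subseteq> W.span ?G"
    by (rule cyclic_subspace_minimal[OF xc C(2) W.subspace_span], rule W.span_base) force
  moreover have "W.span ?G \<subseteq> car W"
    by (rule W.span_minimal[OF _ subspace_car]) (use Lm1_pow_closed Y_closed[OF xc] in auto)
  ultimately have "W.span ?G = car W" using cyclic_subspace_eq_car[OF x(1,3,2)] by simp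
  moreover have "countable ?G" using C(1) by (intro countable_image countable_SIGMA) auto
  ultimately show thesis by (intro that)
qed

text \<open>A mode of degree below \<open>-n\<close> would lead from weight h + n to a weight below
  \<open>h\<close>, where nothing is nonzero.\<close>

lemma eigenspace_subset_Omega: "eigenspace (h + of_nat n) \<subseteq> Omega V W (int n)"
proof
  fix w assume w: "w \<in> eigenspace (h + of_nat n)"
  have "mY W v k w = 0" if "v \<in> weight_space V m" "m - k - 1 < - int n" for m v k
    using generator_eigenspace[of w "int n" v m 0 k] w that h(2)[of "int n + m - k - 1"] by auto
  then show "w \<in> Omega V W (int n)"
    using subsetD[OF eigenspace_subset w] by (simp add: Omega_def)
qed

section \<open>Finite-dimensional weight spaces of irreducible modules\<close>

context
  assumes A: "\<And>N. finite_dimensional (A_alg V N)"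
begin

text \<open>A single lowest weight vector \<open>x\<close> is enough: degree-zero modes carry it
  onto the whole space, and finitely many of them already span all their values on
  \<open>x\<close>.\<close>

lemma fin_dim_lowest_weight_space: "fin_dim (scl W) (eigenspace h)"
proof -
  obtain G where G: "countable G" "W.span G = car W" by (rule countably_spanned)
  obtain x where x: "x \<in> eigenspace h" "x \<noteq> 0" "mL1 W x = 0" by (rule lowest_weight_vector)
  obtain U where U: "finite U" "\<And>v w. w \<in> Omega V W (int 0) \<Longrightarrow>
      residue_action V W 0 0 v w \<in> W.span ((\<lambda>u. residue_action V W 0 0 u w) ` U)"
    by (rule finitely_many_residue_actions[OF A G, of 0]) blast
  have "x \<in> Omega V W (int 0)" using eigenspace_subset_Omega[of 0] x(1) by auto
  moreover have "eigenspace h \<subseteq> range (\<lambda>v. residue_action V W 0 0 v x)"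
    using lowest_weight_space_covered[of x 0] x by simp
  ultimately have "eigenspace h \<subseteq> W.span ((\<lambda>u. residue_action V W 0 0 u x) ` U)"
    using U(2) by blast
  then show ?thesis unfolding fin_dim_def using U(1) by blast
qed

lemma fin_dim_eigenspace: "fin_dim (scl W) (eigenspace (h + of_nat n))"
proof (induction n)
  case 0
  then show ?case using fin_dim_lowest_weight_space by simp
next
  case (Suc m)
  let ?n = "Suc m" and ?S = "eigenspace (h + of_nat (Suc m))"
  obtain G where G: "countable G" "W.span G = car W" by (rule countably_spanned)
  obtain U where U: "finite U" "\<And>v w. w \<in> Omega V W (int ?n) \<Longrightarrow>
      residue_action V W 0 ?n v w \<in> W.span ((\<lambda>u. residue_action V W 0 ?n u w) ` U)"
    by (rule finitely_many_residue_actions[OF A G, of ?n]) blast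
  let ?I = "insert (mL1 W) ((\<lambda>u. residue_action V W 0 ?n u) ` U)"
  show ?case
  proof (rule W.fin_dim_common_kernel[of ?I])
    show "finite ?I" using U(1) by simp
    show "W.subspace ?S" by (rule subspace_eigenspace)
    show "linear_on (scl W) (scl W) ?S f" if "f \<in> ?I" for f
      using that linear_on_subset[OF linear_on_L1 eigenspace_subset]
        linear_on_subset[OF linear_on_residue_action eigenspace_subset] by blast
    show "fin_dim (scl W) (f ` ?S)" if f: "f \<in> ?I" for f
    proof (cases "f = mL1 W")
      case True
      have "mL1 W ` ?S \<subseteq> eigenspace (h + of_nat m)"
        using L1_eigenspace[of _ "h + of_nat (Suc m)"] by (auto simp: algebra_simps)
      then show ?thesis using W.fin_dim_subset[OF Suc] True by simp
    next
      case False
      then obtain u where "f = residue_action V W 0 ?n u" using f by blast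
      then have "f ` ?S \<subseteq> eigenspace h"
        using residue_action_eigenspace[of _ "h + of_nat (Suc m)" 0 ?n u] by auto
      then show ?thesis by (rule W.fin_dim_subset[OF fin_dim_lowest_weight_space])
    qed
    \<comment> \<open>The set \<open>U\<close> serves every vector of Omega_n(W), so vanishing of
      its modes on \<open>x\<close> means that all modes of degree \<open>-n\<close> vanish on
      \<open>x\<close>. If \<open>x\<close> were nonzero, these would cover the nonzero lowest
      weight space, because \<open>mL1 W\<close> also kills \<open>x\<close>.\<close>
    have "x = 0" if x: "x \<in> ?S" "\<forall>f\<in>?I. f x = 0" for x
    proof (rule ccontr)
      assume "x \<noteq> 0"
      then have "eigenspace h \<subseteq> range (\<lambda>v. residue_action V W 0 ?n v x)"
        using lowest_weight_space_covered[OF x(1)] x(2) by simp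
      moreover have "residue_action V W 0 ?n v x = 0" for v
      proof -
        have "(\<lambda>u. residue_action V W 0 ?n u x) ` U \<subseteq> {0}" using x(2) by auto
        then have "W.span ((\<lambda>u. residue_action V W 0 ?n u x) ` U) \<subseteq> {0}"
          using W.span_minimal[OF _ W.subspace_single_0] by blast
        then show ?thesis using U(2)[of x v] eigenspace_subset_Omega[of ?n] x(1) by blast
      qed
      ultimately show False
        using h(1) W.subspace_0[OF subspace_eigenspace[of h]] by auto
    qed
    then have "{x \<in> ?S. \<forall>f\<in>?I. f x = 0} \<subseteq> {0}" by blast
    then show "fin_dim (scl W) {x \<in> ?S. \<forall>f\<in>?I. f x = 0}"
      using W.fin_dim_subset[OF W.fin_dim_zero] by blast
  qed
qed

end

end

lemma fin_dim_gen_weight_space: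
  assumes A: "\<And>N. finite_dimensional (A_alg V N)"
  shows "fin_dim (scl W) (gen_weight_space W a)"
proof -
  obtain h where h: "eigenspace h \<noteq> {0}" "\<And>j::int. j < 0 \<Longrightarrow> eigenspace (h + of_int j) = {0}"
    by (rule lowest_weight_exists) blast
  show ?thesis
  proof (cases "eigenspace a = {0}")
    case True
    then show ?thesis by (simp add: gen_weight_space_eq_eigenspace W.fin_dim_zero)
  next
    case False
    then obtain n :: nat where "a = h + of_nat n" using weights[OF h] by blast
    then show ?thesis
      using fin_dim_eigenspace[OF h A, of n] by (simp add: gen_weight_space_eq_eigenspace)
  qed
qed

lemma ordinary:
  assumes A: "\<And>N. finite_dimensional (A_alg V N)"
  shows "ordinary_module V W"
proof -
  have "{w \<in> car W. \<exists>n. mL0 W w = scl W n w} = (\<Union>a. eigenspace a)"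
    by (auto simp: eigenspace_def)
  then show ?thesis
    using fin_dim_gen_weight_space[OF A] moebius_W span_eigenspaces
      finite_dimensional_iff_fin_dim[OF W.vector_space_axioms subspace_gen_weight_space]
    by (simp add: ordinary_module_def grading_restricted_module_def)
qed

end

section \<open>Extensions by irreducible quotients and modules of finite length\<close>

context moebius_module
begin

text \<open>
  The quotient \<open>F / D\<close> is realized on a complement of \<open>D\<close> in \<open>F\<close>, because sets of cosets
  do not form a vector space on a type.
\<close>

lemma fin_dim_gen_weight_space_extension:
  assumes A: "\<And>N. finite_dimensional (A_alg V N)"
    and F: "gen_submodule W F" and D: "gen_submodule W D" "D \<subseteq> F"
    and irred: "irreducible_gen_module (quotient_gen_module W F D)"
    and fin: "fin_dim (scl W) (gen_weight_space W n \<inter> D)"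
  shows "fin_dim (scl W) (gen_weight_space W n \<inter> F)"
proof -
  have subF: "W.subspace F" "F \<subseteq> car W"
    and F_ops: "\<And>v k w. w \<in> F \<Longrightarrow> mY W v k w \<in> F" "\<And>w. w \<in> F \<Longrightarrow> mL0 W w \<in> F"
      "\<And>w. w \<in> F \<Longrightarrow> mLm1 W w \<in> F" "\<And>w. w \<in> F \<Longrightarrow> mL1 W w \<in> F"
    using F unfolding gen_submodule_iff by blast+
  have subD: "W.subspace D" "D \<subseteq> car W"
    and D_ops: "\<And>v k w. w \<in> D \<Longrightarrow> mY W v k w \<in> D" "\<And>w. w \<in> D \<Longrightarrow> mL0 W w \<in> D"
      "\<And>w. w \<in> D \<Longrightarrow> mLm1 W w \<in> D" "\<And>w. w \<in> D \<Longrightarrow> mL1 W w \<in> D"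
    using D(1) unfolding gen_submodule_iff by blast+
  have Fc: "w \<in> car W" if "w \<in> F" for w using subF that by blast
  obtain p where p: "linear_on (scl W) (scl W) UNIV p" and p_D: "\<And>x. x \<in> D \<Longrightarrow> p x = 0"
    and p_diff: "\<And>x. x \<in> F \<Longrightarrow> x - p x \<in> D"
    by (rule W.complement_projection[OF subD(1) subF(1) D(2)]) blast
  note p_lin = linear_on_add[OF p UNIV_I UNIV_I] linear_on_scale[OF p UNIV_I]
    WW.linear_on_diff[OF p W.subspace_UNIV UNIV_I UNIV_I]
  have p0: "p 0 = 0" by (rule p_D[OF W.subspace_0[OF subD(1)]])
  have p_F: "p x \<in> F" if "x \<in> F" for x
    using W.subspace_diff[OF subF(1) that, of "x - p x"] p_diff[OF that] D(2) by auto
  have ker: "x \<in> D" if "x \<in> F" "p x = 0" for x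
    using p_diff[OF that(1)] that(2) by simp
  \<comment> \<open>Replacing \<open>x\<close> by its representative \<open>p x\<close> changes
    \<open>f x\<close> only by an element of \<open>D\<close>, which \<open>p\<close> kills. Hence
    compressing operators by \<open>p\<close> is compatible with passing to
    \<open>F / D\<close>.\<close>
  have p_op: "p (f (p x)) = p (f x)" if f: "linear_on (scl W) (scl W) (car W) f"
    "\<And>w. w \<in> D \<Longrightarrow> f w \<in> D" and x: "x \<in> F" for f x
  proof -
    have "f x - f (p x) = f (x - p x)"
      by (rule WW.linear_on_diff[OF f(1) subspace_car Fc Fc, symmetric]) (use x p_F in auto)
    then have "p (f x - f (p x)) = 0" using p_D f(2) p_diff[OF x] by simp
    then show ?thesis by (simp add: p_lin)
  qed
  let ?W0 = "W\<lparr>car := F\<rparr>"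
  interpret W0: vertex_module V ?W0
    by unfold_locales (rule lower_bounded_gen_module_restrict[OF subF F_ops(1-3)])
  define W' where "W' = W\<lparr>car := p ` F, mY := \<lambda>v k w. p (mY W v k w), mL0 := \<lambda>w. p (mL0 W w),
    mLm1 := \<lambda>w. p (mLm1 W w), mL1 := \<lambda>w. p (mL1 W w)\<rparr>"
  have car': "car W' = p ` F" and scl': "scl W' = scl W" by (simp_all add: W'_def)
  have ops': "mY W' v k (p w) = p (mY W v k w)" "mL0 W' (p w) = p (mL0 W w)"
    "mLm1 W' (p w) = p (mLm1 W w)" "mL1 W' (p w) = p (mL1 W w)" if "w \<in> F" for v k w
    using that p_op linear_on_Y linear_on_L0 linear_on_Lm1 linear_on_L1 D_ops
    by (simp_all add: W'_def)
  have p': "linear_on (scl ?W0) (scl W') (car ?W0) p"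
    using linear_on_subset[OF p] by (simp add: scl')
  have mod: "lower_bounded_gen_module V W'"
    by (rule W0.lower_bounded_gen_module_image[OF _ p'])
      (simp_all add: scl' car' W.vector_space_axioms ops')
  have gen': "gen_weight_space W' n = p ` (gen_weight_space W n \<inter> F)"
  proof -
    have "gen_weight_space W' n = p ` gen_weight_space ?W0 n"
      by (rule W0.gen_weight_space_image[OF _ p'])
        (simp_all add: scl' car' W.vector_space_axioms ops')
    also have "gen_weight_space ?W0 n = gen_weight_space W n \<inter> F"
      using subF(2) by (auto simp: gen_weight_space_def)
    finally show ?thesis .
  qed
  have neg: "p (- x) = - p x" for x
    using p_lin(3)[of 0 x] by (simp add: p0)
  have "lower_bounded_gen_moebius_module V W'"
    unfolding lower_bounded_gen_moebius_module_def operator_on_def car' scl'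
    by (intro conjI mod)
      (simp_all add: ops' F_ops p_lin(1)[symmetric] p_lin(2)[symmetric] p_lin(3)[symmetric]
      W.subspace_add[OF subF(1)] W.subspace_scale[OF subF(1)] Fc neg[symmetric]
      linear_on_add[OF linear_on_L1] linear_on_scale[OF linear_on_L1]
      L0_L1_commutator L1_Lm1_commutator L1_Y_commutator)
  then interpret W': moebius_module V W'
    using moebius_V by unfold_locales
  let ?Q = "quotient_gen_module W F D"
  have on_cosets: "on_cosets D f (x +o D) = f x +o D" if "linear_on (scl W) (scl W) (car W) f"
    "\<And>w. w \<in> D \<Longrightarrow> f w \<in> D" "x \<in> F" for f x
    by (rule W.on_cosets_coset[OF that(1) subspace_car subD]) (use that(2,3) Fc in auto)
  have scale_lin: "linear_on (scl W) (scl W) (car W) (scl W c)" for c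
    by (auto simp: linear_on_def W.scale_right_distrib mult.commute)
  have "irreducible_gen_module W'"
    unfolding irreducible_gen_module_def
  proof (intro conjI allI impI)
    show "\<not> is_singleton (car W')"
    proof
      assume "is_singleton (car W')"
      then have "p ` F = {0}"
        using W.subspace_is_singleton_iff W'.subspace_car by (simp add: car' scl')
      then have "F \<subseteq> D" using ker by blast
      then have "cosets F D \<subseteq> {D}"
        using W.coset_eq_self_iff[OF subD(1)] by (auto simp: cosets_def)
      moreover have "D \<in> cosets F D"
        using W.coset_zero[of D] W.subspace_0[OF subF(1)] unfolding cosets_def by force
      ultimately have "cosets F D = {D}" by blast
      then show False using irred by (simp add: irreducible_gen_module_def quotient_gen_module_def)
    qed
  next
    fix S assume "gen_submodule W' S"
    then have S: "W.subspace S" "S \<subseteq> p ` F"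
      and S_ops: "\<And>v k w. w \<in> S \<Longrightarrow> mY W' v k w \<in> S" "\<And>w. w \<in> S \<Longrightarrow> mL0 W' w \<in> S"
        "\<And>w. w \<in> S \<Longrightarrow> mLm1 W' w \<in> S" "\<And>w. w \<in> S \<Longrightarrow> mL1 W' w \<in> S"
      unfolding W'.gen_submodule_iff scl' car' by blast+
    \<comment> \<open>The preimage of \<open>S\<close> in \<open>F\<close> turns a submodule of the
      model into a set of cosets, to which irreducibility of the actual quotient applies.\<close>
    define S' where "S' = {x \<in> F. p x \<in> S}"
    have S': "W.subspace S'"
      unfolding S'_def
      by (rule WW.linear_on_kernel_subspace[OF linear_on_subset[OF p] subF(1) S(1)]) simp
    have S'F: "S' \<subseteq> F" by (auto simp: S'_def)
    have coset_in: "on_cosets D f X \<in> cosets S' D" if f: "linear_on (scl W) (scl W) (car W) f"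
      "\<And>w. w \<in> D \<Longrightarrow> f w \<in> D" "\<And>w. w \<in> S' \<Longrightarrow> f w \<in> S'" and X: "X \<in> cosets S' D" for f X
    proof -
      obtain x where x: "x \<in> S'" "X = x +o D" using X unfolding cosets_def by blast
      then have "on_cosets D f X = f x +o D"
        using on_cosets[OF f(1,2)] S'F by blast
      then show ?thesis using f(3) x(1) unfolding cosets_def by blast
    qed
    have S'_ops: "mY W v k w \<in> S'" "mL0 W w \<in> S'" "mLm1 W w \<in> S'" "mL1 W w \<in> S'"
      if "w \<in> S'" for v k w
      using that S_ops[of "p w"] F_ops[of w] by (auto simp: S'_def ops')
    have "gen_submodule ?Q (cosets S' D)"
      unfolding gen_submodule_def subspace_in_def
    proof (intro conjI ballI allI)
      show "cosets S' D \<noteq> {}" using W.subspace_0[OF S'] unfolding cosets_def by blast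
      show "cosets S' D \<subseteq> car ?Q" using S'F by (auto simp: cosets_def quotient_gen_module_def)
      show "X + Y \<in> cosets S' D" if XY: "X \<in> cosets S' D" "Y \<in> cosets S' D" for X Y
      proof -
        obtain x y where "x \<in> S'" "X = x +o D" "y \<in> S'" "Y = y +o D"
          using XY unfolding cosets_def by blast
        moreover from this have "x + y \<in> S'" using W.subspace_add[OF S'] by blast
        ultimately show ?thesis
          unfolding cosets_def using W.coset_plus[OF subD(1)] by blast
      qed
      fix X assume X: "X \<in> cosets S' D"
      show "scl ?Q c X \<in> cosets S' D" for c
        using coset_in[OF scale_lin _ _ X] W.subspace_scale[OF subD(1)] W.subspace_scale[OF S']
        by (simp add: quotient_gen_module_def)
      show "mY ?Q v k X \<in> cosets S' D" for v k
        using coset_in[OF linear_on_Y D_ops(1) S'_ops(1) X] by (simp add: quotient_gen_module_def)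
      show "mL0 ?Q X \<in> cosets S' D"
        using coset_in[OF linear_on_L0 D_ops(2) S'_ops(2) X] by (simp add: quotient_gen_module_def)
      show "mLm1 ?Q X \<in> cosets S' D"
        using coset_in[OF linear_on_Lm1 D_ops(3) S'_ops(3) X] by (simp add: quotient_gen_module_def)
      show "mL1 ?Q X \<in> cosets S' D"
        using coset_in[OF linear_on_L1 D_ops(4) S'_ops(4) X] by (simp add: quotient_gen_module_def)
    qed
    then have "is_singleton (cosets S' D) \<or> cosets S' D = cosets F D"
      using irred by (simp add: irreducible_gen_module_def quotient_gen_module_def)
    then show "is_singleton S \<or> S = car W'"
    proof
      assume "is_singleton (cosets S' D)"
      then obtain X where X: "cosets S' D = {X}" by (rule is_singletonE)
      have "0 +o D \<in> cosets S' D" using W.subspace_0[OF S'] unfolding cosets_def by blast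
      then have "X = D" using X by (simp add: W.coset_zero)
      have "S \<subseteq> {0}"
      proof
        fix y assume "y \<in> S"
        then obtain x where x: "x \<in> S'" "y = p x" using S(2) by (auto simp: S'_def)
        then have "x +o D \<in> cosets S' D" unfolding cosets_def by blast
        then have "x \<in> D"
          using X \<open>X = D\<close> W.coset_eq_self_iff[OF subD(1)] by simp
        then show "y \<in> {0}" using x(2) p_D by simp
      qed
      then have "S = {0}" using W.subspace_0[OF S(1)] by blast
      then show ?thesis by simp
    next
      assume eq: "cosets S' D = cosets F D"
      have "p y \<in> S" if y: "y \<in> F" for y
      proof -
        have "y +o D \<in> cosets S' D" using y unfolding eq unfolding cosets_def by blast
        then obtain x where x: "x \<in> S'" "y +o D = x +o D" unfolding cosets_def by blast
        then have "p (y - x) = 0" using W.coset_eq_iff[OF subD(1)] p_D by blast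
        then have "p y = p x" by (simp add: p_lin)
        then show ?thesis using x(1) by (simp add: S'_def)
      qed
      then show ?thesis using S(2) by (auto simp: car')
    qed
  qed
  then interpret W': irreducible_moebius_module V W' by unfold_locales
  have sub: "W.subspace (gen_weight_space W n \<inter> F)"
    by (rule W.subspace_inter[OF subspace_gen_weight_space subF(1)])
  \<comment> \<open>On \<open>F\<close> the kernel of \<open>p\<close> is contained in
    \<open>D\<close>, so the kernel is covered by \<open>fin\<close>, while the image is a weight
    space of the irreducible model.\<close>
  show ?thesis
  proof (rule W.fin_dim_kernel_image[OF linear_on_subset[OF p] sub])
    show "fin_dim (scl W) (p ` (gen_weight_space W n \<inter> F))"
      using W'.fin_dim_gen_weight_space[OF A, of n] by (simp add: gen' scl')
    show "fin_dim (scl W) {x \<in> gen_weight_space W n \<inter> F. p x = 0}"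
      by (rule W.fin_dim_subset[OF fin]) (use ker in blast)
  qed simp
qed

text \<open>The chain is climbed from \<open>F (Suc l) = {0}\<close> up to
  \<open>F 0 = car W\<close>, each step being an extension by an irreducible quotient.\<close>

lemma finite_length_grading_restricted:
  assumes A: "\<And>N. finite_dimensional (A_alg V N)" and W: "finite_length W"
  shows "grading_restricted_module V W"
proof -
  obtain l F where F: "F 0 = car W" "F (Suc l) = {0}" "\<forall>i\<le>Suc l. gen_submodule W (F i)"
    "\<forall>i\<le>l. F (Suc i) \<subset> F i \<and> irreducible_gen_module (quotient_gen_module W (F i) (F (Suc i)))"
    using W unfolding finite_length_def by blast
  have "fin_dim (scl W) (gen_weight_space W n \<inter> F i)" if "i \<le> Suc l" for n i
    using that
  proof (induction i rule: inc_induct)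
    case base
    show ?case by (rule W.fin_dim_subset[OF W.fin_dim_zero]) (simp add: F(2))
  next
    case (step i)
    show ?case
      by (rule fin_dim_gen_weight_space_extension[OF A _ _ psubset_imp_subset _ step.IH])
        (use F(3,4) step.hyps in auto)
  qed
  from this[of 0] have "fin_dim (scl W) (gen_weight_space W n)" for n
    using W.fin_dim_subset[of "gen_weight_space W n \<inter> F 0"] gen_weight_space_subset F(1) by auto
  then show ?thesis
    using moebius_W finite_dimensional_iff_fin_dim[OF W.vector_space_axioms subspace_gen_weight_space]
    by (simp add: grading_restricted_module_def)
qed

end

theorem proposition5p8:
  fixes V :: "'v::ab_group_add mva_data"
  assumes "moebius_va V"
    and "\<forall>N. finite_dimensional (A_alg V N)"
  shows "(\<forall>W :: ('v, 'w::ab_group_add) mvmod_data.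
            lower_bounded_gen_moebius_module V W \<and> irreducible_gen_module W
              \<longrightarrow> ordinary_module V W) \<and>
         (\<forall>W :: ('v, 'w) mvmod_data.
            lower_bounded_gen_moebius_module V W \<and> finite_length W
              \<longrightarrow> grading_restricted_module V W)"
proof (intro conjI allI impI)
  fix W :: "('v, 'w) mvmod_data"
  assume "lower_bounded_gen_moebius_module V W \<and> irreducible_gen_module W"
  then interpret irreducible_moebius_module V W
    using assms(1) by unfold_locales auto
  show "ordinary_module V W" by (rule ordinary) (use assms(2) in blast)
next
  fix W :: "('v, 'w) mvmod_data"
  assume W: "lower_bounded_gen_moebius_module V W \<and> finite_length W"
  then interpret moebius_module V W
    using assms(1) by unfold_locales auto
  show "grading_restricted_module V W"
    by (rule finite_length_grading_restricted) (use assms(2) W in blast)+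
qed

end
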